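(* Let $(B,g_B,\mu,\xi_B)$ be a conformal Ricci soliton and let $(F,g_F)$ be an Einstein manifold with factor $\beta$, where $\dim B=m$ and $\dim F=n$. Let $(M,g)=(B\times_f F,\ g_B\oplus f^2 g_F)$ be a warped product of $(B,g_B)$ and $(F,g_F)$ with warping function $f$, and let $\xi_F$ be a conformal vector field on $F$ with factor $2\rho$. Then $(M,g,\mu,\xi)$, with $\xi=\xi_B+\xi_F$, is a conformal Ricci soliton if $H^f=0$ and the warping function $f$ satisfies the quadratic equation $$(2\rho-\mu)f^2+2f\,\xi_B(f)+2\beta+2(1-n)k^2=0,$$ where $k^2=\|\nabla f\|_B^2=g_B(\nabla f,\nabla f)$ for some real number $k$.
   Context: Warped product: for Riemannian manifolds $(B,g_B)$ (base) and $(F,g_F)$ (fiber) and a positive smooth function $f$ on $B$ (warping function), $M=B\times_f F$ is the product manifold $B\times F$ with metric $g=\pi^*g_B+(f\circ\pi)^2\sigma^*g_F$, where $\pi,\sigma$ are the projections onto $B$ and $F$; this metric is also written $g_B\oplus f^2g_F$. Functions and vector fields on $B$ and $F$ are identified with their lifts to $M$. Conformal Ricci soliton: for a Riemannian manifold $(N,h)$, a smooth vector field $\zeta$ on $N$ and a scalar $\nu$, $(N,h,\nu,\zeta)$ is a conformal Ricci soliton if $\mathcal{L}_\zeta h+2\,Ric_h=\nu h$. Here $\mu=2\lambda-(p+\frac2n)$, with $\lambda$ a real constant (soliton constant) and $p$ a scalar field (conformal pressure). A vector field $X$ on $(N,h)$ is conformal with factor $\sigma$ ($\sigma$ a smooth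 function on $N$) if $\mathcal{L}_X h=\sigma h$. $(F,g_F)$ is Einstein with factor $\beta$ if $Ric^F=\beta g_F$. $H^f$ is the Hessian and $\nabla f$ the gradient of $f$ on $(B,g_B)$. *)

theory Defs
  imports "HOL-Analysis.Analysis"
begin

section \<open>Smooth maps between Euclidean spaces\<close>

text \<open>
  These are only used on open sets. In finite dimension, continuity of all iterated directional
  derivatives is the usual notion of a map of class \<open>C\<^sup>k\<close>.
\<close>

primrec C_k_on :: "nat \<Rightarrow> 'a::euclidean_space set \<Rightarrow> ('a \<Rightarrow> 'b::real_normed_vector) \<Rightarrow> bool" where
  "C_k_on 0 S f \<longleftrightarrow> continuous_on S f"
| "C_k_on (Suc k) S f \<longleftrightarrow>
     (\<forall>x\<in>S. f differentiable (at x)) \<and> (\<forall>v. C_k_on k S (\<lambda>x. frechet_derivative f (at x) v))"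

definition smooth_on :: "'a::euclidean_space set \<Rightarrow> ('a \<Rightarrow> 'b::real_normed_vector) \<Rightarrow> bool" where
  "smooth_on S f \<longleftrightarrow> (\<forall>k. C_k_on k S f)"


section \<open>Smooth manifolds\<close>

text \<open>
  A manifold is given by an indexed family of charts \<open>coord A i : cdom A i \<rightarrow> 'e\<close>, \<open>i \<in> index A\<close>,
  and its set of points is the union of the chart domains. The family need not be maximal; it
  determines the smooth structure. The dimension is \<open>DIM('e)\<close>, and \<open>'e\<close> also serves as the
  tangent space at every point, read in a chart.
\<close>

record ('i, 'a, 'e) atlas =
  index :: "'i set"
  cdom :: "'i \<Rightarrow> 'a set"
  coord :: "'i \<Rightarrow> 'a \<Rightarrow> 'e"

definition points :: "('i, 'a, 'e) atlas \<Rightarrow> 'a set" where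
  "points A = (\<Union>i\<in>index A. cdom A i)"

definition cimg :: "('i, 'a, 'e) atlas \<Rightarrow> 'i \<Rightarrow> 'e set" where
  "cimg A i = coord A i ` cdom A i"

definition cinv :: "('i, 'a, 'e) atlas \<Rightarrow> 'i \<Rightarrow> 'e \<Rightarrow> 'a" where
  "cinv A i = inv_into (cdom A i) (coord A i)"

definition overlap :: "('i, 'a, 'e) atlas \<Rightarrow> 'i \<Rightarrow> 'i \<Rightarrow> 'e set" where
  "overlap A i j = coord A i ` (cdom A i \<inter> cdom A j)"

definition transition :: "('i, 'a, 'e) atlas \<Rightarrow> 'i \<Rightarrow> 'i \<Rightarrow> 'e \<Rightarrow> 'e" where
  "transition A i j = coord A j \<circ> cinv A i"

text \<open>The manifold is Hausdorff and second countable by the sort of the type of points.\<close>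

definition smooth_manifold ::
  "('i, 'a::{t2_space,second_countable_topology}, 'e::euclidean_space) atlas \<Rightarrow> bool" where
  "smooth_manifold A \<longleftrightarrow>
     (\<forall>i\<in>index A. open (cdom A i) \<and> open (cimg A i) \<and>
        homeomorphism (cdom A i) (cimg A i) (coord A i) (cinv A i)) \<and>
     (\<forall>i\<in>index A. \<forall>j\<in>index A. smooth_on (overlap A i j) (transition A i j))"

definition prod_atlas ::
  "('i, 'a, 'e) atlas \<Rightarrow> ('j, 'b, 'f) atlas \<Rightarrow> ('i \<times> 'j, 'a \<times> 'b, 'e \<times> 'f) atlas" where
  "prod_atlas A A' =
     \<lparr>index = index A \<times> index A',
      cdom = (\<lambda>(i, j). cdom A i \<times> cdom A' j),
      coord = (\<lambda>(i, j). map_prod (coord A i) (coord A' j))\<rparr>"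


section \<open>Functions, vector fields and tensor fields\<close>

text \<open>
  A vector field and a covariant 2-tensor field are given by their representatives in the charts,
  as functions of the chart coordinates, subject to the transformation law under change of
  charts. Only the values on \<open>cimg A i\<close> for \<open>i \<in> index A\<close> are meaningful. Scalar fields are
  functions of the points.
\<close>

type_synonym ('i, 'e) vfield = "'i \<Rightarrow> 'e \<Rightarrow> 'e"
type_synonym ('i, 'e) tensor2 = "'i \<Rightarrow> 'e \<Rightarrow> 'e \<Rightarrow> 'e \<Rightarrow> real"

definition smooth_function ::
  "('i, 'a, 'e::euclidean_space) atlas \<Rightarrow> ('a \<Rightarrow> real) \<Rightarrow> bool" where
  "smooth_function A s \<longleftrightarrow> (\<forall>i\<in>index A. smooth_on (cimg A i) (s \<circ> cinv A i))"

definition smooth_vector_field ::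
  "('i, 'a, 'e::euclidean_space) atlas \<Rightarrow> ('i, 'e) vfield \<Rightarrow> bool" where
  "smooth_vector_field A X \<longleftrightarrow>
     (\<forall>i\<in>index A. smooth_on (cimg A i) (X i)) \<and>
     (\<forall>i\<in>index A. \<forall>j\<in>index A. \<forall>x\<in>overlap A i j.
        X j (transition A i j x) = frechet_derivative (transition A i j) (at x) (X i x))"

definition riemannian_metric ::
  "('i, 'a, 'e::euclidean_space) atlas \<Rightarrow> ('i, 'e) tensor2 \<Rightarrow> bool" where
  "riemannian_metric A g \<longleftrightarrow>
     (\<forall>i\<in>index A. \<forall>x\<in>cimg A i.
        bilinear (g i x) \<and> (\<forall>u v. g i x u v = g i x v u) \<and> (\<forall>u. u \<noteq> 0 \<longrightarrow> g i x u u > 0)) \<and>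
     (\<forall>i\<in>index A. \<forall>u v. smooth_on (cimg A i) (\<lambda>x. g i x u v)) \<and>
     (\<forall>i\<in>index A. \<forall>j\<in>index A. \<forall>x\<in>overlap A i j. \<forall>u v.
        g j (transition A i j x)
          (frechet_derivative (transition A i j) (at x) u)
          (frechet_derivative (transition A i j) (at x) v) = g i x u v)"

definition riemannian_manifold ::
  "('i, 'a::{t2_space,second_countable_topology}, 'e::euclidean_space) atlas
    \<Rightarrow> ('i, 'e) tensor2 \<Rightarrow> bool" where
  "riemannian_manifold A g \<longleftrightarrow> smooth_manifold A \<and> riemannian_metric A g"

definition tensor_eq ::
  "('i, 'a, 'e) atlas \<Rightarrow> ('i, 'e) tensor2 \<Rightarrow> ('i, 'e) tensor2 \<Rightarrow> bool" where
  "tensor_eq A S T \<longleftrightarrow> (\<forall>i\<in>index A. \<forall>x\<in>cimg A i. \<forall>u v. S i x u v = T i x u v)"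

definition tensor_scale ::
  "('i, 'a, 'e) atlas \<Rightarrow> ('a \<Rightarrow> real) \<Rightarrow> ('i, 'e) tensor2 \<Rightarrow> ('i, 'e) tensor2" where
  "tensor_scale A s T = (\<lambda>i x u v. s (cinv A i x) * T i x u v)"

definition tensor_add :: "('i, 'e) tensor2 \<Rightarrow> ('i, 'e) tensor2 \<Rightarrow> ('i, 'e) tensor2" where
  "tensor_add S T = (\<lambda>i x u v. S i x u v + T i x u v)"

definition vfield_add ::
  "('i, 'e) vfield \<Rightarrow> ('i, 'e::plus) vfield \<Rightarrow> ('i, 'e) vfield" where
  "vfield_add X Y = (\<lambda>i x. X i x + Y i x)"


section \<open>Riemannian geometry in one chart\<close>

text \<open>
  Here a metric is a function \<open>h :: 'e \<Rightarrow> 'e \<Rightarrow> 'e \<Rightarrow> real\<close> of the coordinates, a vector field is a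
  function \<open>'e \<Rightarrow> 'e\<close>, and constant functions are the constant-coefficient combinations of the
  coordinate fields.
\<close>

definition sharp :: "('e \<Rightarrow> 'e \<Rightarrow> real) \<Rightarrow> ('e \<Rightarrow> real) \<Rightarrow> 'e" where
  "sharp b \<alpha> = (THE z. \<forall>w. b z w = \<alpha> w)"

definition bracket ::
  "('e::euclidean_space \<Rightarrow> 'e) \<Rightarrow> ('e \<Rightarrow> 'e) \<Rightarrow> 'e \<Rightarrow> 'e" where
  "bracket X Y x = frechet_derivative Y (at x) (X x) - frechet_derivative X (at x) (Y x)"

text \<open>Koszul's formula for the coordinate fields, contracted with \<open>u\<close> and \<open>v\<close>.\<close>

definition christoffel ::
  "('e::euclidean_space \<Rightarrow> 'e \<Rightarrow> 'e \<Rightarrow> real) \<Rightarrow> 'e \<Rightarrow> 'e \<Rightarrow> 'e \<Rightarrow> 'e" where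
  "christoffel h x u v = sharp (h x) (\<lambda>w.
     (frechet_derivative (\<lambda>y. h y v w) (at x) u
      + frechet_derivative (\<lambda>y. h y u w) (at x) v
      - frechet_derivative (\<lambda>y. h y u v) (at x) w) / 2)"

text \<open>The Levi-Civita connection \<open>\<nabla>\<^sub>X Y\<close>.\<close>

definition cov ::
  "('e::euclidean_space \<Rightarrow> 'e \<Rightarrow> 'e \<Rightarrow> real) \<Rightarrow> ('e \<Rightarrow> 'e) \<Rightarrow> ('e \<Rightarrow> 'e) \<Rightarrow> 'e \<Rightarrow> 'e" where
  "cov h X Y x = frechet_derivative Y (at x) (X x) + christoffel h x (X x) (Y x)"

definition curvature ::
  "('e::euclidean_space \<Rightarrow> 'e \<Rightarrow> 'e \<Rightarrow> real) \<Rightarrow>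
     ('e \<Rightarrow> 'e) \<Rightarrow> ('e \<Rightarrow> 'e) \<Rightarrow> ('e \<Rightarrow> 'e) \<Rightarrow> 'e \<Rightarrow> 'e" where
  "curvature h X Y Z x =
     cov h X (cov h Y Z) x - cov h Y (cov h X Z) x - cov h (bracket X Y) Z x"


section \<open>Ricci tensor, Lie derivative, gradient and Hessian\<close>

text \<open>\<open>Ric(u, v)\<close> is the trace of \<open>w \<mapsto> R(w, u) v\<close>; it is positive on round spheres.\<close>

definition ricci :: "('i, 'e::euclidean_space) tensor2 \<Rightarrow> ('i, 'e) tensor2" where
  "ricci g i x u v =
     (\<Sum>b\<in>Basis. curvature (g i) (\<lambda>_. b) (\<lambda>_. u) (\<lambda>_. v) x \<bullet> b)"

text \<open>\<open>(\<L>\<^sub>X g)(U, V) = X(g(U, V)) - g([X, U], V) - g(U, [X, V])\<close>.\<close>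

definition lie_derivative ::
  "('i, 'e::euclidean_space) vfield \<Rightarrow> ('i, 'e) tensor2 \<Rightarrow> ('i, 'e) tensor2" where
  "lie_derivative X g i x u v =
     frechet_derivative (\<lambda>y. g i y u v) (at x) (X i x)
     - g i x (bracket (X i) (\<lambda>_. u) x) v - g i x u (bracket (X i) (\<lambda>_. v) x)"

definition gradient ::
  "('i, 'a, 'e::euclidean_space) atlas \<Rightarrow> ('i, 'e) tensor2 \<Rightarrow> ('a \<Rightarrow> real) \<Rightarrow> ('i, 'e) vfield" where
  "gradient A g s i x = sharp (g i x) (frechet_derivative (s \<circ> cinv A i) (at x))"

text \<open>\<open>H\<^sup>s(U, V) = U(V(s)) - (\<nabla>\<^sub>U V)(s)\<close>.\<close>

definition hessian ::
  "('i, 'a, 'e::euclidean_space) atlas \<Rightarrow> ('i, 'e) tensor2 \<Rightarrow> ('a \<Rightarrow> real) \<Rightarrow> ('i, 'e) tensor2" where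
  "hessian A g s i x u v =
     frechet_derivative (\<lambda>y. frechet_derivative (s \<circ> cinv A i) (at y) v) (at x) u
     - frechet_derivative (s \<circ> cinv A i) (at x) (cov (g i) (\<lambda>_. u) (\<lambda>_. v) x)"

text \<open>\<open>X(s)\<close> at the point \<open>p \<in> cdom A i\<close>, computed in the chart \<open>i\<close>.\<close>

definition vfield_apply ::
  "('i, 'a, 'e::euclidean_space) atlas \<Rightarrow> ('i, 'e) vfield \<Rightarrow> ('a \<Rightarrow> real) \<Rightarrow> 'i \<Rightarrow> 'a \<Rightarrow> real" where
  "vfield_apply A X s i p =
     frechet_derivative (s \<circ> cinv A i) (at (coord A i p)) (X i (coord A i p))"


section \<open>Einstein manifolds, conformal fields, conformal Ricci solitons\<close>

definition einstein ::
  "('i, 'a::{t2_space,second_countable_topology}, 'e::euclidean_space) atlas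
    \<Rightarrow> ('i, 'e) tensor2 \<Rightarrow> real \<Rightarrow> bool" where
  "einstein A g \<beta> \<longleftrightarrow>
     riemannian_manifold A g \<and> tensor_eq A (ricci g) (tensor_scale A (\<lambda>_. \<beta>) g)"

definition conformal_vector_field ::
  "('i, 'a, 'e::euclidean_space) atlas
    \<Rightarrow> ('i, 'e) tensor2 \<Rightarrow> ('i, 'e) vfield \<Rightarrow> ('a \<Rightarrow> real) \<Rightarrow> bool" where
  "conformal_vector_field A g X s \<longleftrightarrow>
     smooth_vector_field A X \<and> smooth_function A s \<and>
     tensor_eq A (lie_derivative X g) (tensor_scale A s g)"

definition conformal_ricci_soliton ::
  "('i, 'a::{t2_space,second_countable_topology}, 'e::euclidean_space) atlas
    \<Rightarrow> ('i, 'e) tensor2 \<Rightarrow> ('a \<Rightarrow> real) \<Rightarrow> ('i, 'e) vfield \<Rightarrow> bool" where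
  "conformal_ricci_soliton A g \<nu> \<zeta> \<longleftrightarrow>
     riemannian_manifold A g \<and> smooth_vector_field A \<zeta> \<and> smooth_function A \<nu> \<and>
     tensor_eq A (tensor_add (lie_derivative \<zeta> g) (tensor_scale A (\<lambda>_. 2) (ricci g)))
       (tensor_scale A \<nu> g)"


section \<open>Warped products\<close>

text \<open>
  In product charts the projections of \<open>B \<times> F\<close> are \<open>fst\<close> and \<open>snd\<close>, and so are their
  differentials; this gives the pullbacks of tensors and the lifts of vector fields.
\<close>

definition pullback_fst :: "('i, 'e) tensor2 \<Rightarrow> ('i \<times> 'j, 'e \<times> 'f) tensor2" where
  "pullback_fst T k z u v = T (fst k) (fst z) (fst u) (fst v)"

definition pullback_snd :: "('j, 'f) tensor2 \<Rightarrow> ('i \<times> 'j, 'e \<times> 'f) tensor2" where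
  "pullback_snd T k z u v = T (snd k) (snd z) (snd u) (snd v)"

definition warped_metric ::
  "('i, 'a, 'e) atlas \<Rightarrow> ('j, 'b, 'f) atlas \<Rightarrow> ('a \<Rightarrow> real)
    \<Rightarrow> ('i, 'e) tensor2 \<Rightarrow> ('j, 'f) tensor2 \<Rightarrow> ('i \<times> 'j, 'e \<times> 'f) tensor2" where
  "warped_metric B F f gB gF =
     tensor_add (pullback_fst gB)
       (tensor_scale (prod_atlas B F) (\<lambda>p. (f (fst p))\<^sup>2) (pullback_snd gF))"

definition lift_fst :: "('i, 'e) vfield \<Rightarrow> ('i \<times> 'j, 'e \<times> 'f::zero) vfield" where
  "lift_fst X k z = (X (fst k) (fst z), 0)"

definition lift_snd :: "('j, 'f) vfield \<Rightarrow> ('i \<times> 'j, 'e::zero \<times> 'f) vfield" where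
  "lift_snd Y k z = (0, Y (snd k) (snd z))"

end

theory Submission
  imports Defs
begin

text \<open>
  The soliton equation is local, so it is checked in a product chart. There the metric is
  \<open>M = h\<^sub>B + \<phi>\<^sup>2 h\<^sub>F\<close>, where \<open>\<phi>\<close> is the warping function in coordinates. Decompose tangent vectors as
  \<open>u = (u\<^sub>1, u\<^sub>2)\<close> and write \<open>\<theta> = d\<phi>/\<phi>\<close>.

  Two formulas carry the proof. The first holds for every warping function (\<open>lie_derivative_M\<close>):
  for \<open>\<xi> = \<xi>\<^sub>B + \<xi>\<^sub>F\<close> the Lie derivative of \<open>M\<close> is
  \<open>\<L>h\<^sub>B + 2 \<phi> \<xi>\<^sub>B(\<phi>) h\<^sub>F + \<phi>\<^sup>2 \<L>h\<^sub>F\<close>, with no mixed terms because each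
  lifted field depends on its own factor only. The second uses that the Hessian of \<open>\<phi>\<close>
  vanishes (\<open>ricci_M\<close>): the Ricci tensor of \<open>M\<close> is
  \<open>Ric\<^sub>B + Ric\<^sub>F - (n - 1) |\<nabla>\<phi>|\<^sup>2 h\<^sub>F\<close>. On the base directions the soliton equation is then that of
  the base; on the fiber directions all terms are multiples of \<open>h\<^sub>F\<close>, and equality of the
  coefficients is the quadratic equation for \<open>f\<close>.

  The Ricci formula comes from the Christoffel symbols of \<open>M\<close> (\<open>christoffel_M\<close>), which are
  \<open>\<Gamma>\<^sub>B(u\<^sub>1, v\<^sub>1) - \<phi> h\<^sub>F(u\<^sub>2, v\<^sub>2) \<nabla>\<phi>\<close> in the base and
  \<open>\<Gamma>\<^sub>F(u\<^sub>2, v\<^sub>2) + \<theta>(u\<^sub>1) v\<^sub>2 + \<theta>(v\<^sub>1) u\<^sub>2\<close> in the fiber. Only two pieces of the curvature enter the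
  trace: the base part of \<open>R(b, u)v\<close> for \<open>b\<close> in the base, and its fiber part for \<open>b\<close> in the fiber.
  A vanishing Hessian means that \<open>\<nabla>\<phi>\<close> is parallel and that \<open>\<nabla>\<theta> = - \<theta> \<otimes> \<theta>\<close>. With these two
  identities the first piece reduces to the curvature of the base, and the second to the
  curvature of the fiber corrected by \<open>|\<nabla>\<phi>|\<^sup>2\<close> times the curvature tensor of a space form, whose
  trace has the factor \<open>n - 1\<close>.

  To differentiate Christoffel symbols and gradients one must know that raising an index
  with a smooth metric preserves differentiability (\<open>differentiable_sharp\<close>).
\<close>

section \<open>Calculus of directional derivatives and of smooth maps\<close>

abbreviation dir_deriv :: "('a::real_normed_vector \<Rightarrow> 'b::real_normed_vector) \<Rightarrow> 'a \<Rightarrow> 'a \<Rightarrow> 'b" where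
  "dir_deriv f x \<equiv> frechet_derivative f (at x)"

lemma dir_deriv_eqI: "(f has_derivative f') (at x) \<Longrightarrow> dir_deriv f x v = f' v"
  by (metis frechet_derivative_at)

lemma dir_deriv_const: "dir_deriv (\<lambda>_. c) x v = 0"
  by (rule dir_deriv_eqI) (rule has_derivative_const)

lemma has_dir_deriv: "f differentiable (at x) \<Longrightarrow> (f has_derivative dir_deriv f x) (at x)"
  by (simp add: frechet_derivative_works)

lemma linear_dir_deriv: "f differentiable (at x) \<Longrightarrow> linear (dir_deriv f x)"
  by (simp add: linear_frechet_derivative)

lemma differentiable_cong_open:
  assumes "open S" "x \<in> S" "\<And>y. y \<in> S \<Longrightarrow> f y = g y" "f differentiable (at x)"
  shows "g differentiable (at x)"
  using has_derivative_transform_within_open[OF has_dir_deriv[OF assms(4)] assms(1,2,3)]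
  by (rule differentiableI)

lemma dir_deriv_cong_open:
  assumes "open S" "x \<in> S" "\<And>y. y \<in> S \<Longrightarrow> f y = g y" "f differentiable (at x)"
  shows "dir_deriv g x v = dir_deriv f x v"
  using has_derivative_transform_within_open[OF has_dir_deriv[OF assms(4)] assms(1,2,3)]
  by (rule dir_deriv_eqI)

text \<open>
  The set is open so that the values of a map on it determine the derivatives there.
\<close>

lemma C_k_on_cong:
  assumes "open S" "\<And>x. x \<in> S \<Longrightarrow> f x = g x" "C_k_on k S f"
  shows "C_k_on k S g"
  using assms(2,3)
proof (induction k arbitrary: f g)
  case 0
  then show ?case using continuous_on_cong by fastforce
next
  case (Suc k)
  have diff: "f differentiable (at x)" if "x \<in> S" for x using Suc.prems that by simp
  have "C_k_on k S (\<lambda>x. dir_deriv g x v)" for v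
  proof (rule Suc.IH)
    show "dir_deriv f x v = dir_deriv g x v" if "x \<in> S" for x
      using dir_deriv_cong_open[OF assms(1) that Suc.prems(1) diff[OF that]] by simp
    show "C_k_on k S (\<lambda>x. dir_deriv f x v)" using Suc.prems by simp
  qed
  moreover have "g differentiable (at x)" if "x \<in> S" for x
    using differentiable_cong_open[OF assms(1) that Suc.prems(1) diff[OF that]] .
  ultimately show ?case by simp
qed

lemma C_k_on_SucD: "C_k_on (Suc k) S f \<Longrightarrow> C_k_on k S f"
proof (induction k arbitrary: f)
  case 0
  then show ?case
    by (auto intro!: continuous_at_imp_continuous_on differentiable_imp_continuous_within)
qed auto

lemma C_k_on_add:
  assumes "open S" "C_k_on k S f" "C_k_on k S g"
  shows "C_k_on k S (\<lambda>x. f x + g x)"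
  using assms(2,3)
proof (induction k arbitrary: f g)
  case 0
  then show ?case by (auto intro: continuous_intros)
next
  case (Suc k)
  have d: "f differentiable (at x)" "g differentiable (at x)" if "x \<in> S" for x
    using Suc.prems that by auto
  have "C_k_on k S (\<lambda>x. dir_deriv (\<lambda>x. f x + g x) x v)" for v
  proof (rule C_k_on_cong[OF assms(1)])
    show "dir_deriv f x v + dir_deriv g x v = dir_deriv (\<lambda>x. f x + g x) x v" if "x \<in> S" for x
      using dir_deriv_eqI[OF has_derivative_add[OF has_dir_deriv has_dir_deriv], OF d[OF that]]
      by simp
    show "C_k_on k S (\<lambda>x. dir_deriv f x v + dir_deriv g x v)"
      using Suc by simp
  qed
  then show ?case using d by simp
qed

lemma C_k_on_mult:
  fixes f g :: "'a::euclidean_space \<Rightarrow> real"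
  assumes "open S" "C_k_on k S f" "C_k_on k S g"
  shows "C_k_on k S (\<lambda>x. f x * g x)"
  using assms(2,3)
proof (induction k arbitrary: f g)
  case 0
  then show ?case by (auto intro: continuous_intros)
next
  case (Suc k)
  have d: "f differentiable (at x)" "g differentiable (at x)" if "x \<in> S" for x
    using Suc.prems that by auto
  have "C_k_on k S (\<lambda>x. dir_deriv (\<lambda>x. f x * g x) x v)" for v
  proof (rule C_k_on_cong[OF assms(1)])
    show "f x * dir_deriv g x v + dir_deriv f x v * g x = dir_deriv (\<lambda>x. f x * g x) x v"
      if "x \<in> S" for x
      using dir_deriv_eqI[OF has_derivative_mult[OF has_dir_deriv has_dir_deriv], OF d[OF that]]
      by simp
    show "C_k_on k S (\<lambda>x. f x * dir_deriv g x v + dir_deriv f x v * g x)"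
      using Suc.prems C_k_on_SucD[OF Suc.prems(1)] C_k_on_SucD[OF Suc.prems(2)]
      by (intro C_k_on_add[OF assms(1)] Suc.IH) auto
  qed
  then show ?case using d by (simp add: differentiable_mult)
qed

lemma C_k_on_Pair:
  assumes "open S" "C_k_on k S f" "C_k_on k S g"
  shows "C_k_on k S (\<lambda>x. (f x, g x))"
  using assms(2,3)
proof (induction k arbitrary: f g)
  case 0
  then show ?case by (auto intro: continuous_intros)
next
  case (Suc k)
  have d: "f differentiable (at x)" "g differentiable (at x)" if "x \<in> S" for x
    using Suc.prems that by auto
  have hd: "((\<lambda>x. (f x, g x)) has_derivative (\<lambda>v. (dir_deriv f x v, dir_deriv g x v))) (at x)"
    if "x \<in> S" for x
    using d[OF that] by (intro has_derivative_Pair has_dir_deriv)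
  have "C_k_on k S (\<lambda>x. dir_deriv (\<lambda>x. (f x, g x)) x v)" for v
  proof (rule C_k_on_cong[OF assms(1)])
    show "(dir_deriv f x v, dir_deriv g x v) = dir_deriv (\<lambda>x. (f x, g x)) x v" if "x \<in> S" for x
      using dir_deriv_eqI[OF hd[OF that]] by simp
    show "C_k_on k S (\<lambda>x. (dir_deriv f x v, dir_deriv g x v))" using Suc by simp
  qed
  then show ?case using hd by (auto intro: differentiableI)
qed

lemma has_derivative_comp_fst:
  assumes "f differentiable (at (fst z))"
  shows "((\<lambda>z. f (fst z)) has_derivative (\<lambda>v. dir_deriv f (fst z) (fst v))) (at z)"
  using has_derivative_compose[OF has_derivative_fst[OF has_derivative_ident]
      has_dir_deriv[OF assms]] by simp

lemma has_derivative_comp_snd: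
  assumes "f differentiable (at (snd z))"
  shows "((\<lambda>z. f (snd z)) has_derivative (\<lambda>v. dir_deriv f (snd z) (snd v))) (at z)"
  using has_derivative_compose[OF has_derivative_snd[OF has_derivative_ident]
      has_dir_deriv[OF assms]] by simp

lemma C_k_on_comp_fst:
  fixes f :: "'a::euclidean_space \<Rightarrow> 'c::real_normed_vector"
    and T :: "'b::euclidean_space set"
  assumes "open S" "open T" "C_k_on k S f"
  shows "C_k_on k (S \<times> T) (\<lambda>z. f (fst z))"
  using assms(3)
proof (induction k arbitrary: f)
  case 0
  then show ?case by (auto intro!: continuous_on_compose2[of S f] continuous_intros)
next
  case (Suc k)
  note hd = has_derivative_comp_fst[of f]
  have d: "f differentiable (at x)" if "x \<in> S" for x using Suc.prems that by simp
  have "C_k_on k (S \<times> T) (\<lambda>z. dir_deriv (\<lambda>z. f (fst z)) z v)" for v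
  proof (rule C_k_on_cong)
    show "open (S \<times> T)" using assms by (simp add: open_Times)
    show "dir_deriv f (fst z) (fst v) = dir_deriv (\<lambda>z. f (fst z)) z v" if "z \<in> S \<times> T" for z
      by (rule dir_deriv_eqI[OF hd, symmetric]) (use d that in auto)
    show "C_k_on k (S \<times> T) (\<lambda>z. dir_deriv f (fst z) (fst v))"
      using Suc.prems by (intro Suc.IH) simp
  qed
  moreover have "(\<lambda>z. f (fst z)) differentiable (at z)" if "z \<in> S \<times> T" for z
    by (rule differentiableI[OF hd]) (use d that in auto)
  ultimately show ?case by simp
qed

lemma C_k_on_comp_snd:
  fixes f :: "'b::euclidean_space \<Rightarrow> 'c::real_normed_vector"
    and S :: "'a::euclidean_space set"
  assumes "open S" "open T" "C_k_on k T f"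
  shows "C_k_on k (S \<times> T) (\<lambda>z. f (snd z))"
  using assms(3)
proof (induction k arbitrary: f)
  case 0
  then show ?case by (auto intro!: continuous_on_compose2[of T f] continuous_intros)
next
  case (Suc k)
  note hd = has_derivative_comp_snd[of f]
  have d: "f differentiable (at x)" if "x \<in> T" for x using Suc.prems that by simp
  have "C_k_on k (S \<times> T) (\<lambda>z. dir_deriv (\<lambda>z. f (snd z)) z v)" for v
  proof (rule C_k_on_cong)
    show "open (S \<times> T)" using assms by (simp add: open_Times)
    show "dir_deriv f (snd z) (snd v) = dir_deriv (\<lambda>z. f (snd z)) z v" if "z \<in> S \<times> T" for z
      by (rule dir_deriv_eqI[OF hd, symmetric]) (use d that in auto)
    show "C_k_on k (S \<times> T) (\<lambda>z. dir_deriv f (snd z) (snd v))"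
      using Suc.prems by (intro Suc.IH) simp
  qed
  moreover have "(\<lambda>z. f (snd z)) differentiable (at z)" if "z \<in> S \<times> T" for z
    by (rule differentiableI[OF hd]) (use d that in auto)
  ultimately show ?case by simp
qed

lemma smooth_on_cong:
  "open S \<Longrightarrow> (\<And>x. x \<in> S \<Longrightarrow> f x = g x) \<Longrightarrow> smooth_on S f \<Longrightarrow> smooth_on S g"
  unfolding smooth_on_def using C_k_on_cong by blast

lemma smooth_on_add:
  "open S \<Longrightarrow> smooth_on S f \<Longrightarrow> smooth_on S g \<Longrightarrow> smooth_on S (\<lambda>x. f x + g x)"
  by (simp add: smooth_on_def C_k_on_add)

lemma smooth_on_mult:
  fixes f g :: "'a::euclidean_space \<Rightarrow> real"
  shows "open S \<Longrightarrow> smooth_on S f \<Longrightarrow> smooth_on S g \<Longrightarrow> smooth_on S (\<lambda>x. f x * g x)"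
  by (simp add: smooth_on_def C_k_on_mult)

lemma smooth_on_Pair:
  "open S \<Longrightarrow> smooth_on S f \<Longrightarrow> smooth_on S g \<Longrightarrow> smooth_on S (\<lambda>x. (f x, g x))"
  by (simp add: smooth_on_def C_k_on_Pair)

lemma smooth_on_comp_fst:
  "open S \<Longrightarrow> open T \<Longrightarrow> smooth_on S f \<Longrightarrow> smooth_on (S \<times> T) (\<lambda>z. f (fst z))"
  by (simp add: smooth_on_def C_k_on_comp_fst)

lemma smooth_on_comp_snd:
  "open S \<Longrightarrow> open T \<Longrightarrow> smooth_on T f \<Longrightarrow> smooth_on (S \<times> T) (\<lambda>z. f (snd z))"
  by (simp add: smooth_on_def C_k_on_comp_snd)

lemma smooth_on_differentiable: "smooth_on S f \<Longrightarrow> x \<in> S \<Longrightarrow> f differentiable (at x)"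
  unfolding smooth_on_def by (metis C_k_on.simps(2))

lemma smooth_on_dir_deriv: "smooth_on S f \<Longrightarrow> smooth_on S (\<lambda>x. dir_deriv f x v)"
  unfolding smooth_on_def by (metis C_k_on.simps(2))


section \<open>Riemannian geometry of a metric on an open set\<close>

lemma inner_sum_Basis_linear:
  fixes \<beta> :: "'e::euclidean_space \<Rightarrow> real"
  assumes "linear \<beta>"
  shows "(\<Sum>b\<in>Basis. \<beta> b *\<^sub>R b) \<bullet> w = \<beta> w"
proof -
  have "\<beta> w = \<beta> (\<Sum>b\<in>Basis. (w \<bullet> b) *\<^sub>R b)" by (simp add: euclidean_representation)
  also have "\<dots> = (\<Sum>b\<in>Basis. (w \<bullet> b) * \<beta> b)"
    by (simp add: linear_sum[OF assms] linear_cmul[OF assms])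
  finally show ?thesis by (simp add: inner_sum_left inner_commute[of w] mult.commute)
qed

locale metric_chart =
  fixes S :: "'e::euclidean_space set" and h :: "'e \<Rightarrow> 'e \<Rightarrow> 'e \<Rightarrow> real"
  assumes open_S: "open S"
    and bilinear_h: "x \<in> S \<Longrightarrow> bilinear (h x)"
    and sym_h: "x \<in> S \<Longrightarrow> h x u v = h x v u"
    and pos_h: "x \<in> S \<Longrightarrow> u \<noteq> 0 \<Longrightarrow> h x u u > 0"
    and smooth_h: "smooth_on S (\<lambda>x. h x u v)"
begin

lemmas h_simps =
  bilinear_ladd[OF bilinear_h] bilinear_radd[OF bilinear_h]
  bilinear_lsub[OF bilinear_h] bilinear_rsub[OF bilinear_h]
  bilinear_lmul[OF bilinear_h] bilinear_rmul[OF bilinear_h]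
  bilinear_lzero[OF bilinear_h] bilinear_rzero[OF bilinear_h]
  bilinear_lneg[OF bilinear_h] bilinear_rneg[OF bilinear_h]

lemma linear_h_right: "x \<in> S \<Longrightarrow> linear (h x u)"
  using bilinear_h by (simp add: bilinear_def)

lemma linear_h_left: "x \<in> S \<Longrightarrow> linear (\<lambda>u. h x u v)"
  using bilinear_h by (simp add: bilinear_def)

lemma nondegenerate:
  assumes "x \<in> S" "\<And>w. h x u w = h x v w"
  shows "u = v"
proof (rule ccontr)
  assume "u \<noteq> v"
  then have "h x (u - v) (u - v) > 0" using pos_h[OF assms(1)] by simp
  moreover have "h x (u - v) (u - v) = 0"
    using assms by (simp add: h_simps)
  ultimately show False by simp
qed

lemma sharp_eqI:
  assumes "x \<in> S" "\<And>w. h x z w = \<alpha> w"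
  shows "sharp (h x) \<alpha> = z"
  unfolding sharp_def using assms nondegenerate[OF assms(1)] by (intro the_equality) auto

lemma h_sharp:
  assumes x: "x \<in> S" and \<alpha>: "linear \<alpha>"
  shows "h x (sharp (h x) \<alpha>) w = \<alpha> w"
proof -
  define L where "L z = (\<Sum>b\<in>Basis. h x z b *\<^sub>R b)" for z
  have L: "L z \<bullet> w = h x z w" for z w
    unfolding L_def by (rule inner_sum_Basis_linear[OF linear_h_right[OF x]])
  have linL: "linear L"
    by (rule linearI; rule vector_eq_ldot[THEN iffD1])
       (simp_all add: L inner_add_right inner_add_left inner_commute[of _ "L _"] h_simps[OF x])
  \<comment> \<open>An injective endomorphism is surjective in finite dimension.\<close>
  have injL: "inj L"
  proof (rule injI)
    fix u v assume "L u = L v"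
    then have "h x u w = h x v w" for w using L[of u w] L[of v w] by simp
    then show "u = v" using nondegenerate[OF x] by blast
  qed
  have "surj L" using linear_injective_imp_surjective[OF linL injL] by simp
  then obtain z where "L z = (\<Sum>b\<in>Basis. \<alpha> b *\<^sub>R b)" by (metis surjD)
  then have z: "h x z w = \<alpha> w" for w
    using L[of z w] inner_sum_Basis_linear[OF \<alpha>, of w] by simp
  then show ?thesis using sharp_eqI[OF x z] by simp
qed

lemma differentiable_h: "x \<in> S \<Longrightarrow> (\<lambda>x. h x u v) differentiable (at x)"
  using smooth_h smooth_on_differentiable by blast

text \<open>
  The hypothesis on \<open>h\<close> is smoothness in the point for fixed arguments. Expanding the
  argument in the standard basis gives joint differentiability in the point and the argument.
\<close>

lemma has_derivative_h:
  assumes x: "x \<in> S"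
  shows "((\<lambda>p. h (fst p) (snd p) w) has_derivative
           (\<lambda>q. h x (snd q) w + dir_deriv (\<lambda>y. h y z w) x (fst q))) (at (x, z))"
proof -
  have ex: "h y z w = (\<Sum>c\<in>Basis. (z \<bullet> c) * h y c w)" if "y \<in> S" for y z
  proof -
    have "h y z w = h y (\<Sum>c\<in>Basis. (z \<bullet> c) *\<^sub>R c) w" by (simp add: euclidean_representation)
    then show ?thesis
      by (simp add: linear_sum[OF linear_h_left[OF that]] linear_cmul[OF linear_h_left[OF that]])
  qed
  have d: "((\<lambda>p. h (fst p) c w) has_derivative (\<lambda>q. dir_deriv (\<lambda>y. h y c w) x (fst q))) (at (x, z))"
    for c using has_derivative_comp_fst[of "\<lambda>y. h y c w" "(x, z)"] differentiable_h[OF x] by simp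
  have dz: "dir_deriv (\<lambda>y. h y z w) x v = (\<Sum>c\<in>Basis. (z \<bullet> c) * dir_deriv (\<lambda>y. h y c w) x v)" for v
  proof (rule dir_deriv_eqI)
    have "((\<lambda>y. \<Sum>c\<in>Basis. (z \<bullet> c) * h y c w) has_derivative
            (\<lambda>v. \<Sum>c\<in>Basis. (z \<bullet> c) * dir_deriv (\<lambda>y. h y c w) x v)) (at x)"
      by (intro has_derivative_sum has_derivative_mult_right has_dir_deriv differentiable_h[OF x])
    then show "((\<lambda>y. h y z w) has_derivative
            (\<lambda>v. \<Sum>c\<in>Basis. (z \<bullet> c) * dir_deriv (\<lambda>y. h y c w) x v)) (at x)"
      by (rule has_derivative_transform_within_open[OF _ open_S x]) (simp add: ex)
  qed
  have "((\<lambda>p. \<Sum>c\<in>Basis. (snd p \<bullet> c) * h (fst p) c w) has_derivative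
          (\<lambda>q. \<Sum>c\<in>Basis. (snd (x, z) \<bullet> c) * dir_deriv (\<lambda>y. h y c w) x (fst q)
             + (snd q \<bullet> c) * h (fst (x, z)) c w)) (at (x, z))"
    by (intro has_derivative_sum has_derivative_mult has_derivative_inner_left has_derivative_snd
        has_derivative_ident d)
  then have "((\<lambda>p. \<Sum>c\<in>Basis. (snd p \<bullet> c) * h (fst p) c w) has_derivative
           (\<lambda>q. h x (snd q) w + dir_deriv (\<lambda>y. h y z w) x (fst q))) (at (x, z))"
    by (rule has_derivative_eq_rhs)
       (simp add: fun_eq_iff dz ex[OF x, of "snd _"] sum.distrib add.commute)
  then show ?thesis
    by (rule has_derivative_transform_within_open[of _ _ _ _ "S \<times> UNIV"])
       (auto simp: open_Times open_S x ex[symmetric])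
qed

lemma dir_deriv_h_sym:
  "x \<in> S \<Longrightarrow> dir_deriv (\<lambda>y. h y u v) x w = dir_deriv (\<lambda>y. h y v u) x w"
  by (rule dir_deriv_cong_open[OF open_S _ _ differentiable_h]) (simp_all add: sym_h)

lemma bilinear_dir_deriv_h:
  assumes x: "x \<in> S"
  shows "bilinear (\<lambda>u v. dir_deriv (\<lambda>y. h y u v) x w)"
proof -
  have add: "dir_deriv (\<lambda>y. h y (u + u') v) x w
      = dir_deriv (\<lambda>y. h y u v) x w + dir_deriv (\<lambda>y. h y u' v) x w" for u u' v
  proof (rule dir_deriv_eqI[where f' = "\<lambda>w. dir_deriv (\<lambda>y. h y u v) x w + dir_deriv (\<lambda>y. h y u' v) x w"])
    have "((\<lambda>y. h y u v + h y u' v) has_derivative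
       (\<lambda>w. dir_deriv (\<lambda>y. h y u v) x w + dir_deriv (\<lambda>y. h y u' v) x w)) (at x)"
      by (intro has_derivative_add has_dir_deriv differentiable_h x)
    then show "((\<lambda>y. h y (u + u') v) has_derivative
       (\<lambda>w. dir_deriv (\<lambda>y. h y u v) x w + dir_deriv (\<lambda>y. h y u' v) x w)) (at x)"
      by (rule has_derivative_transform_within_open[OF _ open_S x]) (simp add: h_simps)
  qed
  have scale: "dir_deriv (\<lambda>y. h y (c *\<^sub>R u) v) x w = c * dir_deriv (\<lambda>y. h y u v) x w" for c u v
  proof (rule dir_deriv_eqI[where f' = "\<lambda>w. c * dir_deriv (\<lambda>y. h y u v) x w"])
    have "((\<lambda>y. c * h y u v) has_derivative (\<lambda>w. c * dir_deriv (\<lambda>y. h y u v) x w)) (at x)"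
      by (intro has_derivative_mult_right has_dir_deriv differentiable_h x)
    then show "((\<lambda>y. h y (c *\<^sub>R u) v) has_derivative (\<lambda>w. c * dir_deriv (\<lambda>y. h y u v) x w)) (at x)"
      by (rule has_derivative_transform_within_open[OF _ open_S x]) (simp add: h_simps)
  qed
  have "linear (\<lambda>u. dir_deriv (\<lambda>y. h y u v) x w)" for v
    by (rule linearI) (simp_all add: add scale)
  moreover have "linear (\<lambda>v. dir_deriv (\<lambda>y. h y u v) x w)" for u
    by (rule linearI) (simp_all only: dir_deriv_h_sym[OF x, of u] add scale real_scaleR_def)
  ultimately show ?thesis by (simp add: bilinear_def)
qed

text \<open>
  Raising an index inverts the map \<open>(x, z) \<mapsto> (x, h\<^sub>x(z, \<cdot>))\<close>, with covectors identified with
  vectors by the inner product. This map is differentiable with invertible derivative,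
  so its inverse is differentiable as well.
\<close>

lemma differentiable_sharp:
  assumes x: "x \<in> S" and lin: "\<And>y. y \<in> S \<Longrightarrow> linear (\<alpha> y)"
    and diff: "\<And>w. (\<lambda>y. \<alpha> y w) differentiable (at x)"
  shows "(\<lambda>y. sharp (h y) (\<alpha> y)) differentiable (at x)"
proof -
  define f where "f p = (fst p, \<Sum>b\<in>Basis. h (fst p) (snd p) b *\<^sub>R b)" for p
  define g where "g p = (fst p, sharp (h (fst p)) (\<lambda>w. snd p \<bullet> w))" for p :: "'e \<times> 'e"
  define f' where "f' y z q = (fst q,
      \<Sum>b\<in>Basis. (h y (snd q) b + dir_deriv (\<lambda>y. h y z b) y (fst q)) *\<^sub>R b)" for y z q
  define z where "z = sharp (h x) (\<alpha> x)"
  \<comment> \<open>This solves \<open>f' x z q' = q\<close> for \<open>q'\<close>: the second component of \<open>f' x z\<close> is \<open>h\<^sub>x\<close> plus the derivative of \<open>h\<close>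
    at the fixed argument \<open>z\<close>, which is moved to the other side.\<close>
  define g' where "g' q = (fst q, sharp (h x) (\<lambda>w. snd q \<bullet> w - dir_deriv (\<lambda>y. h y z w) x (fst q)))"
    for q :: "'e \<times> 'e"
  have derf: "(f has_derivative f' y z) (at (y, z))" if "y \<in> S" for y z
    unfolding f_def f'_def
    by (intro has_derivative_Pair has_derivative_fst has_derivative_ident has_derivative_sum
        has_derivative_scaleR_left has_derivative_h that)
  have gf: "g (f p) = p" if "p \<in> S \<times> UNIV" for p
  proof -
    have "sharp (h (fst p)) (\<lambda>w. (\<Sum>b\<in>Basis. h (fst p) (snd p) b *\<^sub>R b) \<bullet> w) = snd p"
      using that by (intro sharp_eqI) (auto simp: inner_sum_Basis_linear linear_h_right)
    then show ?thesis by (simp add: g_def f_def)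
  qed
  have "linear (\<lambda>w. snd q \<bullet> w - dir_deriv (\<lambda>y. h y z w) x (fst q))" for q :: "'e \<times> 'e"
    using bilinear_dir_deriv_h[OF x, of "fst q"]
    by (intro linear_compose_sub) (auto simp: bilinear_def bounded_linear.linear bounded_linear_inner_right)
  then have fg': "f' x z \<circ> g' = id"
    by (auto simp: f'_def g'_def h_sharp[OF x] fun_eq_iff euclidean_representation)
  have "continuous_on (S \<times> UNIV) f"
    using derf by (intro continuous_at_imp_continuous_on) (auto intro: has_derivative_continuous)
  then have derg: "(g has_derivative g') (at (f (x, z)))"
    using x by (intro has_derivative_inverse_strong[of "S \<times> UNIV" _ f g "f' x z"])
      (auto simp: open_Times open_S gf derf fg')
  define a where "a y = (y, \<Sum>b\<in>Basis. \<alpha> y b *\<^sub>R b)" for y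
  have dera: "(a has_derivative (\<lambda>v. (v, \<Sum>b\<in>Basis. dir_deriv (\<lambda>y. \<alpha> y b) x v *\<^sub>R b))) (at x)"
    unfolding a_def
    by (intro has_derivative_Pair has_derivative_ident has_derivative_sum
        has_derivative_scaleR_left has_dir_deriv diff)
  have "a x = f (x, z)"
    by (simp add: a_def f_def z_def h_sharp[OF x lin[OF x]])
  with derg have "(g has_derivative g') (at (a x))" by simp
  from differentiableI[OF has_derivative_snd[OF has_derivative_compose[OF dera this]]]
  have "(\<lambda>y. snd (g (a y))) differentiable (at x)" .
  then show ?thesis
    by (rule differentiable_cong_open[OF open_S x, rotated])
       (simp add: g_def a_def inner_sum_Basis_linear[OF lin])
qed

lemma linear_koszul:
  assumes x: "x \<in> S"
  shows "linear (\<lambda>w. (dir_deriv (\<lambda>y. h y v w) x u + dir_deriv (\<lambda>y. h y u w) x v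
                    - dir_deriv (\<lambda>y. h y u v) x w) / 2)"
proof -
  have "linear (\<lambda>w. dir_deriv (\<lambda>y. h y a w) x c)" for a c
    using bilinear_dir_deriv_h[OF x] by (simp add: bilinear_def)
  then have "linear (\<lambda>w. dir_deriv (\<lambda>y. h y v w) x u + dir_deriv (\<lambda>y. h y u w) x v
                    - dir_deriv (\<lambda>y. h y u v) x w)"
    by (intro linear_compose_sub linear_compose_add linear_dir_deriv differentiable_h[OF x])
  from linear_compose_scale_right[OF this, of "1/2"] show ?thesis by simp
qed

lemma h_christoffel:
  assumes "x \<in> S"
  shows "h x (christoffel h x u v) w =
    (dir_deriv (\<lambda>y. h y v w) x u + dir_deriv (\<lambda>y. h y u w) x v - dir_deriv (\<lambda>y. h y u v) x w) / 2"
  unfolding christoffel_def by (rule h_sharp[OF assms linear_koszul[OF assms]])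

lemma christoffel_eqI:
  assumes "x \<in> S"
    and "\<And>w. 2 * h x z w =
      dir_deriv (\<lambda>y. h y v w) x u + dir_deriv (\<lambda>y. h y u w) x v - dir_deriv (\<lambda>y. h y u v) x w"
  shows "christoffel h x u v = z"
  using assms(2) by (intro nondegenerate[OF assms(1)]) (simp add: h_christoffel[OF assms(1)] flip: assms(2))

lemma christoffel_sym: "x \<in> S \<Longrightarrow> christoffel h x u v = christoffel h x v u"
  by (rule christoffel_eqI) (simp_all add: h_christoffel dir_deriv_h_sym[of x u v])

lemma bilinear_christoffel:
  assumes x: "x \<in> S"
  shows "bilinear (christoffel h x)"
proof -
  note dh = bilinear_ladd[OF bilinear_dir_deriv_h[OF x]] bilinear_radd[OF bilinear_dir_deriv_h[OF x]]
    bilinear_lmul[OF bilinear_dir_deriv_h[OF x]] bilinear_rmul[OF bilinear_dir_deriv_h[OF x]]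
    linear_add[OF linear_dir_deriv[OF differentiable_h[OF x]]]
    linear_cmul[OF linear_dir_deriv[OF differentiable_h[OF x]]]
  have "linear (christoffel h x u)" for u
    by (rule linearI; rule nondegenerate[OF x])
       (simp_all add: h_simps[OF x] h_christoffel[OF x] dh field_simps)
  moreover from this have "linear (\<lambda>u. christoffel h x u v)" for v
    by (simp add: christoffel_sym[OF x, of _ v])
  ultimately show ?thesis by (simp add: bilinear_def)
qed

lemmas christoffel_simps =
  bilinear_ladd[OF bilinear_christoffel] bilinear_radd[OF bilinear_christoffel]
  bilinear_lsub[OF bilinear_christoffel] bilinear_rsub[OF bilinear_christoffel]
  bilinear_lmul[OF bilinear_christoffel] bilinear_rmul[OF bilinear_christoffel]
  bilinear_lzero[OF bilinear_christoffel] bilinear_rzero[OF bilinear_christoffel]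
  bilinear_lneg[OF bilinear_christoffel] bilinear_rneg[OF bilinear_christoffel]

lemma metric_compatible:
  assumes "x \<in> S"
  shows "dir_deriv (\<lambda>y. h y u v) x w = h x (christoffel h x w u) v + h x u (christoffel h x w v)"
  unfolding sym_h[OF assms, of u] h_christoffel[OF assms]
  using dir_deriv_h_sym[OF assms, of u v w] dir_deriv_h_sym[OF assms, of w u v] dir_deriv_h_sym[OF assms, of w v u]
  by (simp add: field_simps)

lemma differentiable_christoffel:
  assumes x: "x \<in> S"
  shows "(\<lambda>y. christoffel h y u v) differentiable (at x)"
proof -
  have "(\<lambda>y. dir_deriv (\<lambda>y. h y a b) y c) differentiable (at x)" for a b c
    using smooth_on_differentiable[OF smooth_on_dir_deriv[OF smooth_h] x] .
  then show ?thesis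
    unfolding christoffel_def
    by (intro differentiable_sharp[OF x linear_koszul] differentiable_divide differentiable_diff
        differentiable_add differentiable_const) simp_all
qed

text \<open>
  Constant fields commute, and their covariant derivatives are the Christoffel symbols.
\<close>

lemma curvature_const:
  assumes x: "x \<in> S"
  shows "curvature h (\<lambda>_. b) (\<lambda>_. u) (\<lambda>_. v) x =
    dir_deriv (\<lambda>y. christoffel h y u v) x b + christoffel h x b (christoffel h x u v)
    - dir_deriv (\<lambda>y. christoffel h y b v) x u - christoffel h x u (christoffel h x b v)"
proof -
  have "cov h (\<lambda>_. a) (\<lambda>_. c) = (\<lambda>y. christoffel h y a c)" for a c
    by (simp add: cov_def dir_deriv_const fun_eq_iff)
  then show ?thesis
    by (simp add: curvature_def cov_def bracket_def dir_deriv_const christoffel_simps[OF x]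
        linear_0[OF linear_dir_deriv])
qed

definition grad :: "('e \<Rightarrow> real) \<Rightarrow> 'e \<Rightarrow> 'e" where
  "grad \<phi> x = sharp (h x) (dir_deriv \<phi> x)"

lemma h_grad:
  assumes "smooth_on S \<phi>" "x \<in> S"
  shows "h x (grad \<phi> x) w = dir_deriv \<phi> x w"
  unfolding grad_def
  using assms by (intro h_sharp linear_dir_deriv) (auto intro: smooth_on_differentiable)

lemma differentiable_grad:
  assumes "smooth_on S \<phi>" "x \<in> S"
  shows "grad \<phi> differentiable (at x)"
proof -
  have "(\<lambda>y. sharp (h y) (dir_deriv \<phi> y)) differentiable (at x)"
    using assms smooth_on_differentiable smooth_on_dir_deriv
    by (intro differentiable_sharp linear_dir_deriv) blast+
  then show ?thesis by (simp add: grad_def[abs_def])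
qed

text \<open>
  Differentiating \<open>h(\<nabla>\<phi>, w) = d\<phi>(w)\<close> along \<open>u\<close> gives \<open>h(\<nabla>\<^sub>u \<nabla>\<phi>, w) = H\<^sup>\<phi>(u, w)\<close>, because the
  connection is compatible with the metric.
\<close>

lemma grad_parallel:
  assumes \<phi>: "smooth_on S \<phi>" and x: "x \<in> S"
    and hess: "\<And>v. dir_deriv (\<lambda>y. dir_deriv \<phi> y v) x u = dir_deriv \<phi> x (christoffel h x u v)"
  shows "dir_deriv (grad \<phi>) x u + christoffel h x u (grad \<phi> x) = 0"
proof (rule nondegenerate[OF x])
  fix w
  let ?G = "grad \<phi>"
  have pair: "((\<lambda>y. h y (?G y) w) has_derivative
      (\<lambda>v. h x (dir_deriv ?G x v) w + dir_deriv (\<lambda>y. h y (?G x) w) x v)) (at x)"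
    using has_derivative_compose[OF has_derivative_Pair[OF has_derivative_ident
          has_dir_deriv[OF differentiable_grad[OF \<phi> x]]] has_derivative_h[OF x, of w]]
    by simp
  have "((\<lambda>y. dir_deriv \<phi> y w) has_derivative
      (\<lambda>v. h x (dir_deriv ?G x v) w + dir_deriv (\<lambda>y. h y (?G x) w) x v)) (at x)"
    by (rule has_derivative_transform_within_open[OF pair open_S x]) (rule h_grad[OF \<phi>])
  from dir_deriv_eqI[OF this, of u]
  have "h x (?G x) (christoffel h x u w) = h x (dir_deriv ?G x u) w + dir_deriv (\<lambda>y. h y (?G x) w) x u"
    by (simp add: hess h_grad[OF \<phi> x])
  then show "h x (dir_deriv ?G x u + christoffel h x u (?G x)) w = h x 0 w"
    by (simp add: metric_compatible[OF x] h_simps[OF x])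
qed

lemma lie_derivative_eq:
  assumes g: "g i = h" and x: "x \<in> S" and X: "X i differentiable (at x)"
  shows "lie_derivative X g i x u v = dir_deriv (\<lambda>y. h y u v) x (X i x)
    + h x (dir_deriv (X i) x u) v + h x u (dir_deriv (X i) x v)"
  by (simp add: lie_derivative_def g bracket_def dir_deriv_const h_simps[OF x])

end

section \<open>Warped products of charts\<close>

text \<open>
  The metric \<open>M\<close> is a separate parameter, prescribed on \<open>S \<times> T\<close> only, since
  the warped metric of two manifolds takes unspecified values outside the chart.
\<close>

locale warped_chart = base: metric_chart S hB + fiber: metric_chart T hF
  for S :: "'e::euclidean_space set" and hB and T :: "'f::euclidean_space set" and hF +
  fixes \<phi> :: "'e \<Rightarrow> real" and M :: "'e \<times> 'f \<Rightarrow> 'e \<times> 'f \<Rightarrow> 'e \<times> 'f \<Rightarrow> real"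
  assumes smooth_\<phi>: "smooth_on S \<phi>" and pos_\<phi>: "x \<in> S \<Longrightarrow> \<phi> x > 0"
    and M_eq: "z \<in> S \<times> T \<Longrightarrow>
      M z u v = hB (fst z) (fst u) (fst v) + (\<phi> (fst z))\<^sup>2 * hF (snd z) (snd u) (snd v)"
begin

lemma smooth_M: "smooth_on (S \<times> T) (\<lambda>z. M z u v)"
proof (rule smooth_on_cong)
  show o: "open (S \<times> T)" by (simp add: open_Times base.open_S fiber.open_S)
  show "hB (fst z) (fst u) (fst v) + (\<phi> (fst z) * \<phi> (fst z)) * hF (snd z) (snd u) (snd v) = M z u v"
    if "z \<in> S \<times> T" for z using M_eq[OF that] by (simp add: power2_eq_square)
  show "smooth_on (S \<times> T)
     (\<lambda>z. hB (fst z) (fst u) (fst v) + (\<phi> (fst z) * \<phi> (fst z)) * hF (snd z) (snd u) (snd v))"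
    by (intro smooth_on_add smooth_on_mult o smooth_\<phi> base.smooth_h fiber.smooth_h
        smooth_on_comp_fst[of S T \<phi>] smooth_on_comp_fst[of S T "\<lambda>x. hB x (fst u) (fst v)"]
        smooth_on_comp_snd[of S T "\<lambda>y. hF y (snd u) (snd v)"] base.open_S fiber.open_S)
qed

sublocale total: metric_chart "S \<times> T" M
proof
  show "open (S \<times> T)" by (simp add: open_Times base.open_S fiber.open_S)
  fix z u v assume z: "z \<in> S \<times> T"
  then have B: "fst z \<in> S" and F: "snd z \<in> T" by auto
  note simps = base.h_simps[OF B] fiber.h_simps[OF F]
  show "bilinear (M z)"
    unfolding bilinear_def
    by (intro conjI allI linearI) (simp_all add: M_eq[OF z] simps algebra_simps)
  show "M z u v = M z v u" by (simp add: M_eq[OF z] base.sym_h[OF B] fiber.sym_h[OF F])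
  assume "u \<noteq> 0"
  then consider "fst u \<noteq> 0" | "snd u \<noteq> 0" by (auto simp: prod_eq_iff)
  moreover have "hB (fst z) a a \<ge> 0" "hF (snd z) c c \<ge> 0" for a c
    using base.pos_h[OF B, of a] base.h_simps[OF B] fiber.pos_h[OF F, of c] fiber.h_simps[OF F]
    by (cases "a = 0"; cases "c = 0"; simp add: less_imp_le)+
  ultimately show "M z u u > 0"
    using base.pos_h[OF B] fiber.pos_h[OF F] pos_\<phi>[OF B]
    by cases (simp_all add: M_eq[OF z] add_pos_nonneg add_nonneg_pos)
qed (rule smooth_M)

lemma differentiable_\<phi>: "x \<in> S \<Longrightarrow> \<phi> differentiable (at x)"
  using smooth_on_differentiable[OF smooth_\<phi>] .

lemma dir_deriv_M:
  assumes z: "(x, y) \<in> S \<times> T"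
  shows "dir_deriv (\<lambda>z. M z u v) (x, y) w =
    dir_deriv (\<lambda>x. hB x (fst u) (fst v)) x (fst w)
    + 2 * \<phi> x * dir_deriv \<phi> x (fst w) * hF y (snd u) (snd v)
    + (\<phi> x)\<^sup>2 * dir_deriv (\<lambda>y. hF y (snd u) (snd v)) y (snd w)"
proof (rule dir_deriv_eqI[THEN trans])
  let ?D = "\<lambda>w. dir_deriv (\<lambda>x. hB x (fst u) (fst v)) x (fst w)
    + (\<phi> x * \<phi> x * dir_deriv (\<lambda>y. hF y (snd u) (snd v)) y (snd w)
      + (\<phi> x * dir_deriv \<phi> x (fst w) + dir_deriv \<phi> x (fst w) * \<phi> x) * hF y (snd u) (snd v))"
  have B: "x \<in> S" and F: "y \<in> T" using z by auto
  have "((\<lambda>z. hB (fst z) (fst u) (fst v) + (\<phi> (fst z) * \<phi> (fst z)) * hF (snd z) (snd u) (snd v))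
     has_derivative ?D) (at (x, y))"
    using has_derivative_add[OF has_derivative_comp_fst[of "\<lambda>x. hB x (fst u) (fst v)" "(x, y)"]
        has_derivative_mult[OF has_derivative_mult[OF has_derivative_comp_fst[of \<phi> "(x, y)"]
            has_derivative_comp_fst[of \<phi> "(x, y)"]]
          has_derivative_comp_snd[of "\<lambda>y. hF y (snd u) (snd v)" "(x, y)"]]]
      differentiable_\<phi>[OF B] base.differentiable_h[OF B] fiber.differentiable_h[OF F]
    by simp
  then show "((\<lambda>z. M z u v) has_derivative ?D) (at (x, y))"
    by (rule has_derivative_transform_within_open[OF _ total.open_S z])
       (simp add: M_eq power2_eq_square)
  show "?D w = dir_deriv (\<lambda>x. hB x (fst u) (fst v)) x (fst w)
    + 2 * \<phi> x * dir_deriv \<phi> x (fst w) * hF y (snd u) (snd v)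
    + (\<phi> x)\<^sup>2 * dir_deriv (\<lambda>y. hF y (snd u) (snd v)) y (snd w)"
    by (simp add: power2_eq_square algebra_simps)
qed

text \<open>The differential of \<open>ln \<phi>\<close>.\<close>

definition \<theta> :: "'e \<Rightarrow> 'e \<Rightarrow> real" where
  "\<theta> x u = dir_deriv \<phi> x u / \<phi> x"

text \<open>
  The stated vector satisfies Koszul's formula, which determines it. The gradient of \<open>\<phi>\<close> comes
  from differentiating the factor \<open>\<phi>\<^sup>2\<close> in the direction of the third argument, and \<open>\<theta>\<close> from
  differentiating it in the directions of the first two.
\<close>

lemma christoffel_M:
  assumes z: "(x, y) \<in> S \<times> T"
  shows "christoffel M (x, y) u v =
    (christoffel hB x (fst u) (fst v) - (\<phi> x * hF y (snd u) (snd v)) *\<^sub>R base.grad \<phi> x,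
     christoffel hF y (snd u) (snd v) + \<theta> x (fst u) *\<^sub>R snd v + \<theta> x (fst v) *\<^sub>R snd u)"
proof (rule total.christoffel_eqI[OF z])
  fix w
  have B: "x \<in> S" and F: "y \<in> T" using z by auto
  have nz: "\<phi> x \<noteq> 0" using pos_\<phi>[OF B] by simp
  show "2 * M (x, y) (christoffel hB x (fst u) (fst v) - (\<phi> x * hF y (snd u) (snd v)) *\<^sub>R base.grad \<phi> x,
     christoffel hF y (snd u) (snd v) + \<theta> x (fst u) *\<^sub>R snd v + \<theta> x (fst v) *\<^sub>R snd u) w =
    dir_deriv (\<lambda>z. M z v w) (x, y) u + dir_deriv (\<lambda>z. M z u w) (x, y) v
    - dir_deriv (\<lambda>z. M z u v) (x, y) w"
    using nz
    by (simp add: M_eq[OF z] dir_deriv_M[OF z] base.h_simps[OF B] fiber.h_simps[OF F]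
        base.h_christoffel[OF B] fiber.h_christoffel[OF F] base.h_grad[OF smooth_\<phi> B] \<theta>_def
        field_simps power2_eq_square)
qed

lemma lie_derivative_M:
  assumes z: "(x, y) \<in> S \<times> T" and g: "g i = M" "gB j = hB" "gF l = hF"
    and X: "\<And>z. X i z = (XB j (fst z), XF l (snd z))"
    and dB: "XB j differentiable (at x)" and dF: "XF l differentiable (at y)"
  shows "lie_derivative X g i (x, y) u v = lie_derivative XB gB j x (fst u) (fst v)
    + 2 * \<phi> x * dir_deriv \<phi> x (XB j x) * hF y (snd u) (snd v)
    + (\<phi> x)\<^sup>2 * lie_derivative XF gF l y (snd u) (snd v)"
proof -
  have B: "x \<in> S" and F: "y \<in> T" using z by auto
  have D: "(X i has_derivative (\<lambda>w. (dir_deriv (XB j) x (fst w), dir_deriv (XF l) y (snd w)))) (at (x, y))"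
    using has_derivative_Pair[OF has_derivative_comp_fst[of "XB j" "(x, y)"]
        has_derivative_comp_snd[of "XF l" "(x, y)"]] dB dF
    by (simp add: X[abs_def])
  show ?thesis
    by (simp add: total.lie_derivative_eq[where g = g and X = X and i = i, OF g(1) z differentiableI[OF D]]
        base.lie_derivative_eq[where g = gB and X = XB and i = j, OF g(2) B dB] fiber.lie_derivative_eq[where g = gF and X = XF and i = l, OF g(3) F dF]
        dir_deriv_eqI[OF D] dir_deriv_M[OF z] M_eq[OF z] X algebra_simps)
qed

end

lemma sum_Basis_prod:
  fixes s :: "'e::euclidean_space \<times> 'f::euclidean_space \<Rightarrow> real"
  shows "sum s Basis = (\<Sum>b\<in>Basis. s (b, 0)) + (\<Sum>b\<in>Basis. s (0, b))"
  unfolding Basis_prod_def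
  by (subst sum.union_disjoint) (auto simp: Basis_prod_def sum.reindex inj_on_def)

text \<open>
  A function with vanishing Hessian is affine along each geodesic, hence the name.
\<close>

locale affine_warped_chart = warped_chart S hB T hF \<phi> M
  for S :: "'e::euclidean_space set" and hB and T :: "'f::euclidean_space set" and hF \<phi> M +
  assumes hessian_\<phi>: "x \<in> S \<Longrightarrow>
    dir_deriv (\<lambda>y. dir_deriv \<phi> y v) x u = dir_deriv \<phi> x (christoffel hB x u v)"
begin

lemma linear_\<theta>: "x \<in> S \<Longrightarrow> linear (\<theta> x)"
  unfolding \<theta>_def
  using linear_compose_scale_right[OF linear_dir_deriv[OF differentiable_\<phi>], of x "1 / \<phi> x"]
  by simp

lemma \<theta>_grad: "x \<in> S \<Longrightarrow> \<phi> x * \<theta> x (base.grad \<phi> x) = hB x (base.grad \<phi> x) (base.grad \<phi> x)"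
  using pos_\<phi>[of x] by (simp add: \<theta>_def base.h_grad[OF smooth_\<phi>])

text \<open>
  This is the identity \<open>\<nabla>\<theta> = - \<theta> \<otimes> \<theta>\<close>: the quotient rule contributes \<open>- \<theta> \<otimes> \<theta>\<close>, and the
  Hessian of \<open>\<phi>\<close> contributes nothing.
\<close>

lemma has_derivative_\<theta>:
  assumes x: "x \<in> S"
  shows "((\<lambda>x. \<theta> x u) has_derivative (\<lambda>b. \<theta> x (christoffel hB x b u) - \<theta> x b * \<theta> x u)) (at x)"
proof -
  have nz: "\<phi> x \<noteq> 0" using pos_\<phi>[OF x] by simp
  have "(\<lambda>y. dir_deriv \<phi> y u) differentiable (at x)"
    using smooth_on_differentiable[OF smooth_on_dir_deriv[OF smooth_\<phi>] x] .
  from has_derivative_divide'[OF has_dir_deriv[OF this] has_dir_deriv[OF differentiable_\<phi>[OF x]] nz]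
  show ?thesis unfolding \<theta>_def
    by (rule has_derivative_eq_rhs) (use nz in \<open>simp add: fun_eq_iff hessian_\<phi>[OF x] field_simps\<close>)
qed

lemma dir_deriv_christoffel_M:
  assumes z: "(x, y) \<in> S \<times> T"
  shows "dir_deriv (\<lambda>z. christoffel M z u v) (x, y) b =
    (dir_deriv (\<lambda>x. christoffel hB x (fst u) (fst v)) x (fst b)
      - ((\<phi> x * hF y (snd u) (snd v)) *\<^sub>R dir_deriv (base.grad \<phi>) x (fst b)
        + (\<phi> x * dir_deriv (\<lambda>y. hF y (snd u) (snd v)) y (snd b)
          + dir_deriv \<phi> x (fst b) * hF y (snd u) (snd v)) *\<^sub>R base.grad \<phi> x),
     dir_deriv (\<lambda>y. christoffel hF y (snd u) (snd v)) y (snd b)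
      + (\<theta> x (christoffel hB x (fst b) (fst u)) - \<theta> x (fst b) * \<theta> x (fst u)) *\<^sub>R snd v
      + (\<theta> x (christoffel hB x (fst b) (fst v)) - \<theta> x (fst b) * \<theta> x (fst v)) *\<^sub>R snd u)"
    (is "_ = ?D b")
proof (rule dir_deriv_eqI)
  have B: "x \<in> S" and F: "y \<in> T" using z by auto
  have comp_\<theta>: "((\<lambda>z. \<theta> (fst z) a) has_derivative
      (\<lambda>b. \<theta> x (christoffel hB x (fst b) a) - \<theta> x (fst b) * \<theta> x a)) (at (x, y))" for a
  proof -
    have "((\<lambda>x. \<theta> x a) has_derivative (\<lambda>b. \<theta> x (christoffel hB x b a) - \<theta> x b * \<theta> x a))
        (at (fst (x, y)))"
      using has_derivative_\<theta>[OF B] by simp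
    from has_derivative_compose[OF has_derivative_fst[OF has_derivative_ident] this]
    show ?thesis by simp
  qed
  have fiber_part: "((\<lambda>z. christoffel hF (snd z) (snd u) (snd v) + \<theta> (fst z) (fst u) *\<^sub>R snd v
      + \<theta> (fst z) (fst v) *\<^sub>R snd u) has_derivative (\<lambda>b. snd (?D b))) (at (x, y))"
    using has_derivative_add[OF has_derivative_add[OF
          has_derivative_comp_snd[of "\<lambda>y. christoffel hF y (snd u) (snd v)" "(x, y)"]
          has_derivative_scaleR_left[OF comp_\<theta>, of "fst u" "snd v"]]
        has_derivative_scaleR_left[OF comp_\<theta>, of "fst v" "snd u"]]
      fiber.differentiable_christoffel[OF F]
    by simp
  have base_part: "((\<lambda>z. christoffel hB (fst z) (fst u) (fst v)
      - (\<phi> (fst z) * hF (snd z) (snd u) (snd v)) *\<^sub>R base.grad \<phi> (fst z)) has_derivative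
      (\<lambda>b. fst (?D b))) (at (x, y))"
    using has_derivative_diff[OF
        has_derivative_comp_fst[of "\<lambda>x. christoffel hB x (fst u) (fst v)" "(x, y)"]
        has_derivative_scaleR[OF has_derivative_mult[OF has_derivative_comp_fst[of \<phi> "(x, y)"]
            has_derivative_comp_snd[of "\<lambda>y. hF y (snd u) (snd v)" "(x, y)"]]
          has_derivative_comp_fst[of "base.grad \<phi>" "(x, y)"]]]
      base.differentiable_christoffel[OF B] differentiable_\<phi>[OF B] fiber.differentiable_h[OF F]
      base.differentiable_grad[OF smooth_\<phi> B]
    by simp
  have eq: "christoffel M p u v = (christoffel hB (fst p) (fst u) (fst v)
      - (\<phi> (fst p) * hF (snd p) (snd u) (snd v)) *\<^sub>R base.grad \<phi> (fst p),
      christoffel hF (snd p) (snd u) (snd v) + \<theta> (fst p) (fst u) *\<^sub>R snd v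
      + \<theta> (fst p) (fst v) *\<^sub>R snd u)" if "p \<in> S \<times> T" for p
    using christoffel_M[of "fst p" "snd p"] that by simp
  have "((\<lambda>p. (christoffel hB (fst p) (fst u) (fst v)
      - (\<phi> (fst p) * hF (snd p) (snd u) (snd v)) *\<^sub>R base.grad \<phi> (fst p),
      christoffel hF (snd p) (snd u) (snd v) + \<theta> (fst p) (fst u) *\<^sub>R snd v
      + \<theta> (fst p) (fst v) *\<^sub>R snd u)) has_derivative ?D) (at (x, y))"
    by (rule has_derivative_eq_rhs[OF has_derivative_Pair[OF base_part fiber_part]]) simp
  then show "((\<lambda>z. christoffel M z u v) has_derivative ?D) (at (x, y))"
    by (rule has_derivative_transform_within_open[OF _ total.open_S z eq[symmetric]])
qed

text \<open>
  The terms with \<open>h\<^sub>F(u\<^sub>2, v\<^sub>2)\<close> are \<open>\<phi> \<nabla>\<^sub>b \<nabla>\<phi>\<close>, which is zero as the gradient is parallel, and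
  \<open>d\<phi>(b) \<nabla>\<phi>\<close>, which occurs once in the derivative of \<open>\<Gamma>(u, v)\<close> and once with the other
  sign in \<open>\<Gamma>(u, \<Gamma>(b, v))\<close>.
\<close>

lemma curvature_M_base:
  assumes z: "(x, y) \<in> S \<times> T"
  shows "fst (curvature M (\<lambda>_. (b, 0)) (\<lambda>_. u) (\<lambda>_. v) (x, y))
    = curvature hB (\<lambda>_. b) (\<lambda>_. fst u) (\<lambda>_. fst v) x"
proof -
  have B: "x \<in> S" and F: "y \<in> T" using z by auto
  have par: "dir_deriv (base.grad \<phi>) x a = - christoffel hB x a (base.grad \<phi> x)" for a
    using base.grad_parallel[OF smooth_\<phi> B hessian_\<phi>[OF B], of a] by (simp add: eq_neg_iff_add_eq_0)
  have \<phi>\<theta>: "\<phi> x * \<theta> x a = dir_deriv \<phi> x a" for a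
    using pos_\<phi>[OF B] by (simp add: \<theta>_def)
  have h0: "dir_deriv (\<lambda>y. hF y 0 c) y a = 0" for a c
    using bilinear_lzero[OF fiber.bilinear_dir_deriv_h[OF F]] .
  note h0' = linear_0[OF linear_dir_deriv[OF fiber.differentiable_h[OF F]]]
  show ?thesis
    by (simp add: total.curvature_const[OF z] base.curvature_const[OF B]
        dir_deriv_christoffel_M[OF z] christoffel_M[OF z] par h0 h0'
        base.christoffel_simps[OF B] fiber.christoffel_simps[OF F] fiber.h_simps[OF F]
        linear_0[OF linear_\<theta>[OF B]] algebra_simps \<phi>\<theta>[symmetric])
qed

text \<open>
  The terms with a single factor \<open>\<theta>\<close> cancel by the symmetry of \<open>\<Gamma>\<^sub>F\<close>, and the multiples of \<open>b\<close>
  coming from the derivative and the square of \<open>\<theta>\<close> cancel by \<open>\<nabla>\<theta> = - \<theta> \<otimes> \<theta>\<close>. What remains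
  comes from the gradient component of the Christoffel symbols, through \<open>\<phi> \<theta>(\<nabla>\<phi>) = |\<nabla>\<phi>|\<^sup>2\<close>.
\<close>

lemma curvature_M_fiber:
  assumes z: "(x, y) \<in> S \<times> T"
  shows "snd (curvature M (\<lambda>_. (0, b)) (\<lambda>_. u) (\<lambda>_. v) (x, y))
    = curvature hF (\<lambda>_. b) (\<lambda>_. snd u) (\<lambda>_. snd v) y
      - hB x (base.grad \<phi> x) (base.grad \<phi> x) *\<^sub>R
        (hF y (snd u) (snd v) *\<^sub>R b - hF y b (snd v) *\<^sub>R snd u)"
proof -
  have B: "x \<in> S" and F: "y \<in> T" using z by auto
  have h0: "dir_deriv \<phi> x 0 = 0"
    using linear_0[OF linear_dir_deriv[OF differentiable_\<phi>[OF B]]] .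
  note lin = linear_0[OF linear_\<theta>[OF B]] linear_diff[OF linear_\<theta>[OF B]]
    linear_add[OF linear_\<theta>[OF B]] linear_cmul[OF linear_\<theta>[OF B]] linear_neg[OF linear_\<theta>[OF B]]
  show ?thesis
    by (simp add: total.curvature_const[OF z] fiber.curvature_const[OF F]
        dir_deriv_christoffel_M[OF z] christoffel_M[OF z] \<theta>_grad[OF B, symmetric]
        base.christoffel_simps[OF B] fiber.christoffel_simps[OF F] fiber.h_simps[OF F]
        fiber.christoffel_sym[OF F, of "snd u" b]
        lin algebra_simps)
qed

text \<open>
  In the trace over the fiber, \<open>h\<^sub>F(u\<^sub>2, v\<^sub>2) b\<close> counts the dimension and \<open>h\<^sub>F(b, v\<^sub>2) u\<^sub>2\<close> gives
  \<open>h\<^sub>F(u\<^sub>2, v\<^sub>2)\<close> back, whence the factor \<open>n - 1\<close>.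
\<close>

lemma ricci_M:
  assumes z: "(x, y) \<in> S \<times> T" and g: "g i = M" "gB j = hB" "gF l = hF"
  shows "ricci g i (x, y) u v = ricci gB j x (fst u) (fst v) + ricci gF l y (snd u) (snd v)
    - (real DIM('f) - 1) * hB x (base.grad \<phi> x) (base.grad \<phi> x) * hF y (snd u) (snd v)"
proof -
  have F: "y \<in> T" using z by auto
  have tr: "(\<Sum>b\<in>Basis. (snd u \<bullet> b) * hF y b (snd v)) = hF y (snd u) (snd v)"
  proof -
    have "hF y (snd u) (snd v) = hF y (\<Sum>b\<in>Basis. (snd u \<bullet> b) *\<^sub>R b) (snd v)"
      by (simp add: euclidean_representation)
    then show ?thesis
      by (simp add: linear_sum[OF fiber.linear_h_left[OF F]] linear_cmul[OF fiber.linear_h_left[OF F]])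
  qed
  have "ricci g i (x, y) u v
    = (\<Sum>b\<in>Basis. fst (curvature M (\<lambda>_. (b, 0)) (\<lambda>_. u) (\<lambda>_. v) (x, y)) \<bullet> b)
    + (\<Sum>b\<in>Basis. snd (curvature M (\<lambda>_. (0, b)) (\<lambda>_. u) (\<lambda>_. v) (x, y)) \<bullet> b)"
    by (simp add: ricci_def g sum_Basis_prod inner_prod_def)
  also have "\<dots> = ricci gB j x (fst u) (fst v) + (ricci gF l y (snd u) (snd v)
    - hB x (base.grad \<phi> x) (base.grad \<phi> x) *
      (\<Sum>b\<in>Basis. hF y (snd u) (snd v) - hF y b (snd v) * (snd u \<bullet> b)))"
    by (simp add: curvature_M_base[OF z] curvature_M_fiber[OF z] ricci_def g inner_diff_left
        sum_subtractf sum_distrib_left right_diff_distrib)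
  also have "\<dots> = ricci gB j x (fst u) (fst v) + ricci gF l y (snd u) (snd v)
    - (real DIM('f) - 1) * hB x (base.grad \<phi> x) (base.grad \<phi> x) * hF y (snd u) (snd v)"
    by (simp add: sum_subtractf tr algebra_simps)
  finally show ?thesis .
qed

end

section \<open>Product atlases\<close>

lemma cdom_prod [simp]: "cdom (prod_atlas A A') (i, j) = cdom A i \<times> cdom A' j"
  by (simp add: prod_atlas_def)

lemma coord_prod [simp]: "coord (prod_atlas A A') (i, j) = map_prod (coord A i) (coord A' j)"
  by (simp add: prod_atlas_def)

lemma index_prod [simp]: "index (prod_atlas A A') = index A \<times> index A'"
  by (simp add: prod_atlas_def)

lemma cimg_prod [simp]: "cimg (prod_atlas A A') (i, j) = cimg A i \<times> cimg A' j"
  by (simp add: cimg_def map_prod_surj_on[OF refl refl])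

lemma overlap_prod [simp]:
  "overlap (prod_atlas A A') (i, j) (i', j') = overlap A i i' \<times> overlap A' j j'"
  by (simp add: overlap_def Times_Int_Times map_prod_surj_on[OF refl refl])

lemma cinv_in_cdom: "x \<in> cimg A i \<Longrightarrow> cinv A i x \<in> cdom A i"
  by (simp add: cimg_def cinv_def inv_into_into)

lemma coord_cinv: "x \<in> cimg A i \<Longrightarrow> coord A i (cinv A i x) = x"
  by (simp add: cimg_def cinv_def f_inv_into_f)

lemma cinv_in_points: "i \<in> index A \<Longrightarrow> x \<in> cimg A i \<Longrightarrow> cinv A i x \<in> points A"
  unfolding points_def using cinv_in_cdom by (metis UN_I)

lemma overlap_subset_cimg: "overlap A i j \<subseteq> cimg A i"
  by (auto simp: overlap_def cimg_def)

context
  fixes A :: "('i, 'a::{t2_space,second_countable_topology}, 'e::euclidean_space) atlas"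
  assumes A: "smooth_manifold A"
begin

lemma open_cimg: "i \<in> index A \<Longrightarrow> open (cimg A i)"
  using A by (simp add: smooth_manifold_def)

lemma cinv_coord: "i \<in> index A \<Longrightarrow> p \<in> cdom A i \<Longrightarrow> cinv A i (coord A i p) = p"
  using A by (auto simp: smooth_manifold_def homeomorphism_def)

lemma open_overlap:
  assumes i: "i \<in> index A" and j: "j \<in> index A"
  shows "open (overlap A i j)"
proof -
  have "homeomorphism (cdom A i) (cimg A i) (coord A i) (cinv A i)" "open (cdom A i)" "open (cdom A j)"
    using A i j by (auto simp: smooth_manifold_def)
  then have "openin (top_of_set (cimg A i)) (overlap A i j)"
    unfolding overlap_def
    by (intro homeomorphism_imp_open_map) (auto simp: openin_open)
  then show ?thesis using open_cimg[OF i] openin_open_eq by blast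
qed

lemma smooth_transition:
  "i \<in> index A \<Longrightarrow> j \<in> index A \<Longrightarrow> smooth_on (overlap A i j) (transition A i j)"
  using A by (simp add: smooth_manifold_def)

lemma differentiable_transition:
  "i \<in> index A \<Longrightarrow> j \<in> index A \<Longrightarrow> x \<in> overlap A i j \<Longrightarrow> transition A i j differentiable (at x)"
  using smooth_on_differentiable[OF smooth_transition] .

lemma transition_overlap:
  assumes "i \<in> index A" "j \<in> index A" "x \<in> overlap A i j"
  shows "transition A i j x \<in> cimg A j" "cinv A j (transition A i j x) = cinv A i x"
  using assms cinv_coord by (auto simp: overlap_def transition_def cimg_def)

end

lemma metric_chart_of_manifold:
  assumes "riemannian_manifold A g" "i \<in> index A"
  shows "metric_chart (cimg A i) (g i)"
  using assms open_cimg[of A i]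
  by unfold_locales (auto simp: riemannian_manifold_def riemannian_metric_def)

context
  fixes A :: "('i, 'a::{t2_space,second_countable_topology}, 'e::euclidean_space) atlas"
    and A' :: "('j, 'b::{t2_space,second_countable_topology}, 'f::euclidean_space) atlas"
  assumes A: "smooth_manifold A" and A': "smooth_manifold A'"
begin

text \<open>
  The inverse chart is a choice of preimage, so it splits into components only because the
  charts of a manifold are injective.
\<close>

lemma cinv_prod:
  assumes i: "i \<in> index A" and j: "j \<in> index A'" and z: "x \<in> cimg A i" "y \<in> cimg A' j"
  shows "cinv (prod_atlas A A') (i, j) (x, y) = (cinv A i x, cinv A' j y)"
proof -
  have "inj_on (coord A i) (cdom A i)" "inj_on (coord A' j) (cdom A' j)"
    using cinv_coord[OF A i] cinv_coord[OF A' j] by (metis inj_on_inverseI)+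
  then have "inj_on (coord (prod_atlas A A') (i, j)) (cdom (prod_atlas A A') (i, j))"
    by (simp add: map_prod_inj_on)
  then show ?thesis
    unfolding cinv_def[of "prod_atlas A A'"]
    using z by (intro inv_into_f_eq) (auto simp: cinv_in_cdom coord_cinv)
qed

lemma transition_prod:
  assumes "i \<in> index A" "j \<in> index A'" "z \<in> overlap A i i' \<times> overlap A' j j'"
  shows "transition (prod_atlas A A') (i, j) (i', j') z
    = (transition A i i' (fst z), transition A' j j' (snd z))"
proof -
  have "fst z \<in> cimg A i" "snd z \<in> cimg A' j"
    using assms(3) by (auto dest: subsetD[OF overlap_subset_cimg])
  then show ?thesis
    using cinv_prod[OF assms(1,2), of "fst z" "snd z"] by (simp add: transition_def)
qed

lemma dir_deriv_transition_prod:
  assumes i: "i \<in> index A" "i' \<in> index A" and j: "j \<in> index A'" "j' \<in> index A'"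
    and z: "z \<in> overlap A i i' \<times> overlap A' j j'"
  shows "dir_deriv (transition (prod_atlas A A') (i, j) (i', j')) z w
    = (dir_deriv (transition A i i') (fst z) (fst w), dir_deriv (transition A' j j') (snd z) (snd w))"
proof (rule dir_deriv_eqI)
  have "open (overlap A i i' \<times> overlap A' j j')"
    using open_overlap[OF A i] open_overlap[OF A' j] by (rule open_Times)
  then show "(transition (prod_atlas A A') (i, j) (i', j') has_derivative (\<lambda>w.
    (dir_deriv (transition A i i') (fst z) (fst w), dir_deriv (transition A' j j') (snd z) (snd w)))) (at z)"
  proof (rule has_derivative_transform_within_open[rotated, OF _ z])
    show "((\<lambda>z. (transition A i i' (fst z), transition A' j j' (snd z))) has_derivative (\<lambda>w.
    (dir_deriv (transition A i i') (fst z) (fst w), dir_deriv (transition A' j j') (snd z) (snd w)))) (at z)"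
      using z differentiable_transition[OF A i] differentiable_transition[OF A' j]
      by (intro has_derivative_Pair has_derivative_comp_fst has_derivative_comp_snd) auto
  qed (simp add: transition_prod[OF i(1) j(1)])
qed

lemma smooth_manifold_prod: "smooth_manifold (prod_atlas A A')"
  unfolding smooth_manifold_def
proof (intro conjI ballI)
  fix k assume "k \<in> index (prod_atlas A A')"
  then obtain i j where k: "k = (i, j)" and i: "i \<in> index A" and j: "j \<in> index A'" by auto
  show "open (cdom (prod_atlas A A') k)"
    using A A' i j by (simp add: k smooth_manifold_def open_Times)
  show "open (cimg (prod_atlas A A') k)"
    using open_cimg[OF A i] open_cimg[OF A' j] by (simp add: k open_Times)
  have h: "homeomorphism (cdom A i) (cimg A i) (coord A i) (cinv A i)"
    "homeomorphism (cdom A' j) (cimg A' j) (coord A' j) (cinv A' j)"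
    using A A' i j by (auto simp: smooth_manifold_def)
  have cont: "continuous_on (cdom A i \<times> cdom A' j) (map_prod (coord A i) (coord A' j))"
    using h unfolding map_prod_def homeomorphism_def case_prod_beta
    by (auto intro!: continuous_intros continuous_on_compose2[of "cdom A i" "coord A i"]
        continuous_on_compose2[of "cdom A' j" "coord A' j"])
  have "continuous_on (cimg A i \<times> cimg A' j) (\<lambda>z. (cinv A i (fst z), cinv A' j (snd z)))"
    using h unfolding homeomorphism_def
    by (auto intro!: continuous_intros continuous_on_compose2[of "cimg A i" "cinv A i"]
        continuous_on_compose2[of "cimg A' j" "cinv A' j"])
  then have cont': "continuous_on (cimg A i \<times> cimg A' j) (cinv (prod_atlas A A') (i, j))"
    by (rule continuous_on_eq) (auto simp: cinv_prod[OF i j])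
  show "homeomorphism (cdom (prod_atlas A A') k) (cimg (prod_atlas A A') k)
      (coord (prod_atlas A A') k) (cinv (prod_atlas A A') k)"
    unfolding k
  proof (rule homeomorphismI)
    show "continuous_on (cdom (prod_atlas A A') (i, j)) (coord (prod_atlas A A') (i, j))"
      using cont by simp
    show "continuous_on (cimg (prod_atlas A A') (i, j)) (cinv (prod_atlas A A') (i, j))"
      using cont' by simp
    show "coord (prod_atlas A A') (i, j) ` cdom (prod_atlas A A') (i, j) \<subseteq> cimg (prod_atlas A A') (i, j)"
      by (simp only: cimg_def)
    show "cinv (prod_atlas A A') (i, j) ` cimg (prod_atlas A A') (i, j) \<subseteq> cdom (prod_atlas A A') (i, j)"
      by (intro image_subsetI cinv_in_cdom)
    show "coord (prod_atlas A A') (i, j) (cinv (prod_atlas A A') (i, j) z) = z"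
      if "z \<in> cimg (prod_atlas A A') (i, j)" for z
      using coord_cinv[OF that] .
    show "cinv (prod_atlas A A') (i, j) (coord (prod_atlas A A') (i, j) p) = p"
      if "p \<in> cdom (prod_atlas A A') (i, j)" for p
    proof -
      have "coord A i (fst p) \<in> cimg A i" "coord A' j (snd p) \<in> cimg A' j"
        using that by (auto simp: cimg_def)
      then show ?thesis
        using that by (cases p) (simp add: cinv_prod[OF i j] cinv_coord[OF A i] cinv_coord[OF A' j])
    qed
  qed
next
  fix k k' assume "k \<in> index (prod_atlas A A')" "k' \<in> index (prod_atlas A A')"
  then obtain i j i' j' where k: "k = (i, j)" "k' = (i', j')" and i: "i \<in> index A" "i' \<in> index A"
    and j: "j \<in> index A'" "j' \<in> index A'" by auto
  note o = open_overlap[OF A i] open_overlap[OF A' j]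
  have "smooth_on (overlap A i i' \<times> overlap A' j j')
      (\<lambda>z. (transition A i i' (fst z), transition A' j j' (snd z)))"
    by (intro smooth_on_Pair smooth_on_comp_fst smooth_on_comp_snd open_Times o
        smooth_transition[OF A i] smooth_transition[OF A' j])
  then show "smooth_on (overlap (prod_atlas A A') k k') (transition (prod_atlas A A') k k')"
    unfolding k overlap_prod
    by (rule smooth_on_cong[rotated 2]) (auto simp: open_Times o transition_prod[OF i(1) j(1)])
qed

lemma smooth_function_fst:
  assumes s: "smooth_function A s"
  shows "smooth_function (prod_atlas A A') (\<lambda>z. s (fst z))"
  unfolding smooth_function_def
proof (rule ballI)
  fix k assume "k \<in> index (prod_atlas A A')"
  then obtain i j where k: "k = (i, j)" and i: "i \<in> index A" and j: "j \<in> index A'" by auto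
  note o = open_cimg[OF A i] open_cimg[OF A' j]
  have "smooth_on (cimg A i) (s \<circ> cinv A i)" using s i by (simp add: smooth_function_def)
  from smooth_on_comp_fst[OF o this]
  show "smooth_on (cimg (prod_atlas A A') k) ((\<lambda>z. s (fst z)) \<circ> cinv (prod_atlas A A') k)"
    unfolding k cimg_prod
    by (rule smooth_on_cong[rotated 2]) (auto simp: open_Times o cinv_prod[OF i j])
qed

lemma smooth_vector_field_sum_of_lifts:
  assumes X: "smooth_vector_field A X" and Y: "smooth_vector_field A' Y"
  shows "smooth_vector_field (prod_atlas A A') (vfield_add (lift_fst X) (lift_snd Y))"
  unfolding smooth_vector_field_def
proof (intro conjI ballI)
  fix k assume "k \<in> index (prod_atlas A A')"
  then obtain i j where k: "k = (i, j)" and i: "i \<in> index A" and j: "j \<in> index A'" by auto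
  note o = open_cimg[OF A i] open_cimg[OF A' j]
  have "smooth_on (cimg A i \<times> cimg A' j) (\<lambda>z. (X i (fst z), Y j (snd z)))"
    using X Y i j
    by (intro smooth_on_Pair smooth_on_comp_fst smooth_on_comp_snd open_Times o)
       (auto simp: smooth_vector_field_def)
  then show "smooth_on (cimg (prod_atlas A A') k) (vfield_add (lift_fst X) (lift_snd Y) k)"
    by (simp add: k vfield_add_def lift_fst_def lift_snd_def)
next
  fix k k' z assume "k \<in> index (prod_atlas A A')" "k' \<in> index (prod_atlas A A')"
    and z: "z \<in> overlap (prod_atlas A A') k k'"
  then obtain i j i' j' where k: "k = (i, j)" "k' = (i', j')" and i: "i \<in> index A" "i' \<in> index A"
    and j: "j \<in> index A'" "j' \<in> index A'" by auto
  have z': "z \<in> overlap A i i' \<times> overlap A' j j'" using z by (simp add: k)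
  then show "vfield_add (lift_fst X) (lift_snd Y) k' (transition (prod_atlas A A') k k' z)
    = dir_deriv (transition (prod_atlas A A') k k') z (vfield_add (lift_fst X) (lift_snd Y) k z)"
    using X Y i j
    by (auto simp: k dir_deriv_transition_prod[OF i j z'] transition_prod[OF i(1) j(1) z']
        vfield_add_def lift_fst_def lift_snd_def smooth_vector_field_def)
qed

end

section \<open>The warped product of Riemannian manifolds\<close>

lemma warped_metric_eq:
  assumes "smooth_manifold B" "smooth_manifold F" "i \<in> index B" "j \<in> index F"
    and "z \<in> cimg B i \<times> cimg F j"
  shows "warped_metric B F f gB gF (i, j) z u v = gB i (fst z) (fst u) (fst v)
    + ((f \<circ> cinv B i) (fst z))\<^sup>2 * gF j (snd z) (snd u) (snd v)"
  using assms(5) cinv_prod[OF assms(1-4), of "fst z" "snd z"]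
  by (auto simp: warped_metric_def tensor_add_def tensor_scale_def pullback_fst_def pullback_snd_def)

lemma warped_chart_of_manifolds:
  assumes B: "riemannian_manifold B gB" and F: "riemannian_manifold F gF"
    and f: "smooth_function B f" "\<forall>b\<in>points B. f b > 0"
    and i: "i \<in> index B" and j: "j \<in> index F"
  shows "warped_chart (cimg B i) (gB i) (cimg F j) (gF j) (f \<circ> cinv B i)
    (warped_metric B F f gB gF (i, j))"
proof -
  interpret base: metric_chart "cimg B i" "gB i" using metric_chart_of_manifold[OF B i] .
  interpret fiber: metric_chart "cimg F j" "gF j" using metric_chart_of_manifold[OF F j] .
  show ?thesis
  proof
    show "smooth_on (cimg B i) (f \<circ> cinv B i)" using f i by (simp add: smooth_function_def)
    show "(f \<circ> cinv B i) x > 0" if "x \<in> cimg B i" for x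
      using f cinv_in_points[OF i that] by simp
    show "warped_metric B F f gB gF (i, j) z u v = gB i (fst z) (fst u) (fst v)
      + ((f \<circ> cinv B i) (fst z))\<^sup>2 * gF j (snd z) (snd u) (snd v)"
      if "z \<in> cimg B i \<times> cimg F j" for z u v
      using B F by (intro warped_metric_eq i j that) (auto simp: riemannian_manifold_def)
  qed
qed

lemma riemannian_manifold_warped:
  assumes B: "riemannian_manifold B gB" and F: "riemannian_manifold F gF"
    and f: "smooth_function B f" "\<forall>b\<in>points B. f b > 0"
  shows "riemannian_manifold (prod_atlas B F) (warped_metric B F f gB gF)"
proof -
  have mB: "smooth_manifold B" and mF: "smooth_manifold F"
    using B F by (auto simp: riemannian_manifold_def)
  let ?M = "warped_metric B F f gB gF"
  have chart: "metric_chart (cimg B i \<times> cimg F j) (?M (i, j))" if "i \<in> index B" "j \<in> index F" for i j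
  proof -
    interpret warped_chart "cimg B i" "gB i" "cimg F j" "gF j" "f \<circ> cinv B i" "?M (i, j)"
      using warped_chart_of_manifolds[OF B F f that] .
    show ?thesis by (rule total.metric_chart_axioms)
  qed
  have "?M k' (transition (prod_atlas B F) k k' z) (dir_deriv (transition (prod_atlas B F) k k') z u)
      (dir_deriv (transition (prod_atlas B F) k k') z v) = ?M k z u v"
    if idx: "k \<in> index (prod_atlas B F)" "k' \<in> index (prod_atlas B F)"
      and ov: "z \<in> overlap (prod_atlas B F) k k'" for k k' z u v
  proof -
    obtain i j i' j' where k: "k = (i, j)" "k' = (i', j')" and i: "i \<in> index B" "i' \<in> index B"
      and j: "j \<in> index F" "j' \<in> index F" using idx by auto
    have z: "z \<in> overlap B i i' \<times> overlap F j j'" using ov by (simp add: k)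
    then have zc: "z \<in> cimg B i \<times> cimg F j" by (auto dest: subsetD[OF overlap_subset_cimg])
    have tz: "transition (prod_atlas B F) (i, j) (i', j') z
        = (transition B i i' (fst z), transition F j j' (snd z))"
      by (rule transition_prod[OF mB mF i(1) j(1) z])
    have "(transition B i i' (fst z), transition F j j' (snd z)) \<in> cimg B i' \<times> cimg F j'"
      using z transition_overlap(1)[OF mB i] transition_overlap(1)[OF mF j] by auto
    then show ?thesis
      using z B F i j
      by (auto simp: k tz dir_deriv_transition_prod[OF mB mF i j z] warped_metric_eq[OF mB mF i(1) j(1) zc]
          warped_metric_eq[OF mB mF i(2) j(2)] transition_overlap(2)[OF mB i]
          riemannian_manifold_def riemannian_metric_def)
  qed
  then have "riemannian_metric (prod_atlas B F) ?M"
    unfolding riemannian_metric_def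
    using metric_chart.bilinear_h[OF chart] metric_chart.sym_h[OF chart] metric_chart.pos_h[OF chart]
      metric_chart.smooth_h[OF chart]
    by (intro conjI ballI allI impI) (auto 0 3)
  then show ?thesis by (simp add: riemannian_manifold_def smooth_manifold_prod[OF mB mF])
qed

lemma hessian_chart:
  "hessian A g s i x u v = dir_deriv (\<lambda>y. dir_deriv (s \<circ> cinv A i) y v) x u
    - dir_deriv (s \<circ> cinv A i) x (christoffel (g i) x u v)"
  by (simp add: hessian_def cov_def dir_deriv_const)

theorem theorem3p4:
  fixes B :: "('i, 'a::{t2_space,second_countable_topology}, 'e::euclidean_space) atlas"
    and F :: "('j, 'b::{t2_space,second_countable_topology}, 'f::euclidean_space) atlas"
    and gB :: "('i, 'e) tensor2" and gF :: "('j, 'f) tensor2"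
    and \<xi>B :: "('i, 'e) vfield" and \<xi>F :: "('j, 'f) vfield"
    and f :: "'a \<Rightarrow> real" and \<rho> :: "'b \<Rightarrow> real"
    and p \<mu> :: "'a \<Rightarrow> real" and lam \<beta> k :: real and m n :: nat
  assumes dim_B: "DIM('e) = m" and dim_F: "DIM('f) = n"
    and pressure: "smooth_function B p"
    and mu: "\<mu> = (\<lambda>b. 2 * lam - (p b + 2 / real n))"
    and soliton_B: "conformal_ricci_soliton B gB \<mu> \<xi>B"
    and einstein_F: "einstein F gF \<beta>"
    and warping: "smooth_function B f" "\<forall>b\<in>points B. f b > 0"
    and conformal_F: "conformal_vector_field F gF \<xi>F (\<lambda>q. 2 * \<rho> q)"
    and hessian_zero: "tensor_eq B (hessian B gB f) (\<lambda>_ _ _ _. 0)"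
    and grad_norm: "\<forall>i\<in>index B. \<forall>x\<in>cimg B i.
          k\<^sup>2 = gB i x (gradient B gB f i x) (gradient B gB f i x)"
    and quadratic: "\<forall>i\<in>index B. \<forall>b\<in>cdom B i. \<forall>q\<in>points F.
          (2 * \<rho> q - \<mu> b) * (f b)\<^sup>2 + 2 * f b * vfield_apply B \<xi>B f i b
            + 2 * \<beta> + 2 * (1 - real n) * k\<^sup>2 = 0"
  shows "conformal_ricci_soliton (prod_atlas B F) (warped_metric B F f gB gF)
           (\<lambda>z. \<mu> (fst z)) (vfield_add (lift_fst \<xi>B) (lift_snd \<xi>F))"
proof -
  let ?P = "prod_atlas B F" and ?M = "warped_metric B F f gB gF"
    and ?\<xi> = "vfield_add (lift_fst \<xi>B) (lift_snd \<xi>F)"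
  have B: "riemannian_manifold B gB" and \<xi>B: "smooth_vector_field B \<xi>B" and \<mu>: "smooth_function B \<mu>"
    using soliton_B by (auto simp: conformal_ricci_soliton_def)
  have F: "riemannian_manifold F gF" using einstein_F by (simp add: einstein_def)
  have \<xi>F: "smooth_vector_field F \<xi>F" using conformal_F by (simp add: conformal_vector_field_def)
  have mB: "smooth_manifold B" and mF: "smooth_manifold F"
    using B F by (auto simp: riemannian_manifold_def)
  have "lie_derivative ?\<xi> ?M c z u v + 2 * ricci ?M c z u v = \<mu> (fst (cinv ?P c z)) * ?M c z u v"
    if c: "c \<in> index ?P" and z: "z \<in> cimg ?P c" for c z u v
  proof -
    obtain i j x y where cz: "c = (i, j)" "z = (x, y)" by (cases c; cases z)
    have i: "i \<in> index B" and j: "j \<in> index F" and x: "x \<in> cimg B i" and y: "y \<in> cimg F j"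
      using c z by (auto simp: cz)
    define b q where "b = cinv B i x" and "q = cinv F j y"
    interpret warped_chart "cimg B i" "gB i" "cimg F j" "gF j" "f \<circ> cinv B i" "?M (i, j)"
      by (rule warped_chart_of_manifolds[OF B F warping i j])
    interpret affine_warped_chart "cimg B i" "gB i" "cimg F j" "gF j" "f \<circ> cinv B i" "?M (i, j)"
    proof
      fix x u v assume "x \<in> cimg B i"
      then show "dir_deriv (\<lambda>y. dir_deriv (f \<circ> cinv B i) y v) x u
          = dir_deriv (f \<circ> cinv B i) x (christoffel (gB i) x u v)"
        using hessian_zero i hessian_chart[of B gB f i x u v] by (simp add: tensor_eq_def)
    qed
    have xy: "(x, y) \<in> cimg B i \<times> cimg F j" using x y by simp
    have grad: "gB i x (base.grad (f \<circ> cinv B i) x) (base.grad (f \<circ> cinv B i) x) = k\<^sup>2"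
      using grad_norm i x by (simp add: gradient_def base.grad_def)
    have ric: "ricci ?M (i, j) (x, y) u v = ricci gB i x (fst u) (fst v)
        + (\<beta> - (real n - 1) * k\<^sup>2) * gF j y (snd u) (snd v)"
      using einstein_F j y unfolding ricci_M[where g = ?M and i = "(i, j)" and gB = gB and j = i and gF = gF and l = j, OF xy refl refl refl]
        grad dim_F
      by (simp add: einstein_def tensor_eq_def tensor_scale_def algebra_simps)
    have "\<xi>B i differentiable (at x)" "\<xi>F j differentiable (at y)"
      using \<xi>B \<xi>F i j x y by (auto simp: smooth_vector_field_def intro: smooth_on_differentiable)
    then have "lie_derivative ?\<xi> ?M (i, j) (x, y) u v = lie_derivative \<xi>B gB i x (fst u) (fst v)
        + 2 * f b * dir_deriv (f \<circ> cinv B i) x (\<xi>B i x) * gF j y (snd u) (snd v)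
        + (f b)\<^sup>2 * lie_derivative \<xi>F gF j y (snd u) (snd v)"
      by (subst lie_derivative_M[where X = ?\<xi> and XB = \<xi>B and XF = \<xi>F and g = ?M and i = "(i, j)" and gB = gB and j = i and gF = gF and l = j, OF xy refl refl refl])
         (auto simp: vfield_add_def lift_fst_def lift_snd_def b_def)
    also have "lie_derivative \<xi>F gF j y (snd u) (snd v) = 2 * \<rho> q * gF j y (snd u) (snd v)"
      using conformal_F j y
      by (simp add: conformal_vector_field_def tensor_eq_def tensor_scale_def q_def)
    finally have lie: "lie_derivative ?\<xi> ?M (i, j) (x, y) u v = lie_derivative \<xi>B gB i x (fst u) (fst v)
        + (2 * f b * dir_deriv (f \<circ> cinv B i) x (\<xi>B i x) + 2 * \<rho> q * (f b)\<^sup>2) * gF j y (snd u) (snd v)"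
      by (simp add: algebra_simps o_def)
    have base: "lie_derivative \<xi>B gB i x (fst u) (fst v) + 2 * ricci gB i x (fst u) (fst v)
        = \<mu> b * gB i x (fst u) (fst v)"
      using soliton_B i x
      by (simp add: conformal_ricci_soliton_def tensor_eq_def tensor_add_def tensor_scale_def b_def)
    have bq: "b \<in> cdom B i" "q \<in> points F"
      using x y j by (auto simp: b_def q_def cinv_in_cdom cinv_in_points)
    have "vfield_apply B \<xi>B f i b = dir_deriv (f \<circ> cinv B i) x (\<xi>B i x)"
      using x by (simp add: vfield_apply_def b_def coord_cinv)
    with quadratic[rule_format, OF i bq]
    have "(2 * \<rho> q - \<mu> b) * (f b)\<^sup>2 + 2 * f b * dir_deriv (f \<circ> cinv B i) x (\<xi>B i x)
        + 2 * \<beta> + 2 * (1 - real n) * k\<^sup>2 = 0"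
      by simp
    then have fiber: "2 * f b * dir_deriv (f \<circ> cinv B i) x (\<xi>B i x) + 2 * \<rho> q * (f b)\<^sup>2
        + 2 * (\<beta> - (real n - 1) * k\<^sup>2) = \<mu> b * (f b)\<^sup>2"
      by (simp add: algebra_simps)
    have M: "?M (i, j) (x, y) u v = gB i x (fst u) (fst v) + (f b)\<^sup>2 * gF j y (snd u) (snd v)"
      using M_eq[OF xy, of u v] by (simp add: b_def)
    have "lie_derivative ?\<xi> ?M (i, j) (x, y) u v + 2 * ricci ?M (i, j) (x, y) u v
        = (lie_derivative \<xi>B gB i x (fst u) (fst v) + 2 * ricci gB i x (fst u) (fst v))
        + (2 * f b * dir_deriv (f \<circ> cinv B i) x (\<xi>B i x) + 2 * \<rho> q * (f b)\<^sup>2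
        + 2 * (\<beta> - (real n - 1) * k\<^sup>2)) * gF j y (snd u) (snd v)"
      unfolding lie ric by (simp add: algebra_simps)
    also have "\<dots> = \<mu> b * ?M (i, j) (x, y) u v"
      unfolding base fiber M by (simp add: algebra_simps)
    finally show ?thesis by (simp add: cz cinv_prod[OF mB mF i j x y] b_def)
  qed
  then have "tensor_eq ?P (tensor_add (lie_derivative ?\<xi> ?M) (tensor_scale ?P (\<lambda>_. 2) (ricci ?M)))
      (tensor_scale ?P (\<lambda>z. \<mu> (fst z)) ?M)"
    unfolding tensor_eq_def tensor_add_def tensor_scale_def by blast
  then show ?thesis
    unfolding conformal_ricci_soliton_def
    using riemannian_manifold_warped[OF B F warping] smooth_vector_field_sum_of_lifts[OF mB mF \<xi>B \<xi>F]
      smooth_function_fst[OF mB mF \<mu>]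
    by blast
qed

end
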